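(* Let $q$ be a prime power and let $n$ be a positive integer with $3\mid n$ and $n\ge 9$; put $\ell=n/3$. Then there exists a $q$-ary Singleton-optimal locally repairable code of length $n$, minimum distance $d=7$ and locality $r=2$ with disjoint repair groups if and only if there exist $\ell$ lines $L_1,L_2,\dots,L_\ell$ in $PG(3,q)$ such that: (i) for any $1\le i\ne j\le \ell$, $L_i\cap L_j=\emptyset$; (ii) there exist three distinct points $P_{i,1},P_{i,2},P_{i,3}$ on $L_i$ ($i=1,2,\dots,\ell$) such that $P_{s,\mu},P_{t,\nu},P_{m,\omega}$ do not lie on a common line for any $1\le s<t<m\le \ell$ and any $\mu,\nu,\omega\in\{1,2,3\}$.
   Context: Codes are linear: an $[n,k,d]_q$ code $C$ is a $k$-dimensional subspace of $\mathbb{F}_q^n$ ($k\ge 1$) with minimum Hamming distance $d$; $C^\perp$ is its dual code. $C$ is a locally repairable code (LRC) with locality $r$ if for every coordinate $i\in[n]=\{1,\dots,n\}$ there is a codeword $\bm h\in C^\perp$ with $i\in\mathrm{supp}(\bm h)$ and Hamming weight at most $r+1$. When $(r+1)\mid n$, $C$ has disjoint repair groups if there are $\ell=n/(r+1)$ codewords $\bm h_1,\dots,\bm h_\ell\in C^\perp$, each of Hamming weight exactly $r+1$, with pairwise disjoint supports (so the supports partition $[n]$). Convention on optimality: when $(r+1)\mid n$, an LRC is called Singleton-optimal if $n-k=\frac{n}{r+1}+d-2-\left\lfloor\frac{d-2}{r+1}\right\rfloor$. (For $d=7$, $r=2$ the usual Singleton-type bound $d\le n-k-\lceil k/r\rceil+2$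 cannot be met with equality, and this equation is used instead.) Thus for $d=7$, $r=2$, $3\mid n$, Singleton-optimal means $n-k=n/3+4$. $PG(3,q)$ is the projective space whose points and lines are the $1$- and $2$-dimensional subspaces of $\mathbb{F}_q^4$; lines are regarded as sets of points. *)

theory Defs
  imports "HOL-Analysis.Analysis" "HOL-Number_Theory.Prime_Powers"
begin

text \<open>
  A \<open>q\<close>-ary code of length \<open>n\<close> is a subset of \<open>'a ^ 'n\<close>, where \<open>'a\<close> is a finite field with
  \<open>CARD('a) = q\<close> and \<open>'n\<close> is a coordinate set with \<open>CARD('n) = n\<close>.
\<close>

definition supp :: "'a::zero ^ 'n \<Rightarrow> 'n set" where
  "supp v = {i. v $ i \<noteq> 0}"

definition hamming_weight :: "'a::zero ^ 'n::finite \<Rightarrow> nat" where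
  "hamming_weight v = card (supp v)"

definition hamming_dist :: "'a ^ 'n::finite \<Rightarrow> 'a ^ 'n \<Rightarrow> nat" where
  "hamming_dist x y = card {i. x $ i \<noteq> y $ i}"

text \<open>Only meaningful for codes with at least two codewords (\<open>Min {}\<close> is unspecified).\<close>

definition min_dist :: "('a::finite ^ 'n::finite) set \<Rightarrow> nat" where
  "min_dist C = Min {hamming_dist x y | x y. x \<in> C \<and> y \<in> C \<and> x \<noteq> y}"

definition linear_code :: "('a::{field,finite} ^ 'n::finite) set \<Rightarrow> nat \<Rightarrow> nat \<Rightarrow> bool" where
  "linear_code C k d \<longleftrightarrow> vec.subspace C \<and> vec.dim C = k \<and> k \<ge> 1 \<and> min_dist C = d"

definition dual_code :: "('a::field ^ 'n::finite) set \<Rightarrow> ('a ^ 'n) set" where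
  "dual_code C = {h. \<forall>c\<in>C. (\<Sum>i\<in>UNIV. h $ i * c $ i) = 0}"

definition has_locality :: "('a::field ^ 'n::finite) set \<Rightarrow> nat \<Rightarrow> bool" where
  "has_locality C r \<longleftrightarrow> (\<forall>i. \<exists>h\<in>dual_code C. i \<in> supp h \<and> hamming_weight h \<le> r + 1)"

definition disjoint_repair_groups :: "('a::field ^ 'n::finite) set \<Rightarrow> nat \<Rightarrow> bool" where
  "disjoint_repair_groups C r \<longleftrightarrow>
     (r + 1) dvd CARD('n) \<and>
     (\<exists>h :: nat \<Rightarrow> 'a ^ 'n.
        (\<forall>i\<in>{1..CARD('n) div (r + 1)}. h i \<in> dual_code C \<and> hamming_weight (h i) = r + 1) \<and>
        (\<forall>i\<in>{1..CARD('n) div (r + 1)}. \<forall>j\<in>{1..CARD('n) div (r + 1)}.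
           i \<noteq> j \<longrightarrow> supp (h i) \<inter> supp (h j) = {}))"

text \<open>
  The equation is stated over \<open>int\<close> to avoid truncated subtraction; \<open>div\<close> on \<open>int\<close> rounds down,
  so the last term is \<open>\<lfloor>(d - 2) / (r + 1)\<rfloor>\<close>.
\<close>

definition singleton_optimal_lrc ::
    "('a::{field,finite} ^ 'n::finite) set \<Rightarrow> nat \<Rightarrow> nat \<Rightarrow> nat \<Rightarrow> bool" where
  "singleton_optimal_lrc C k d r \<longleftrightarrow>
     linear_code C k d \<and> has_locality C r \<and> (r + 1) dvd CARD('n) \<and>
     int CARD('n) - int k =
       int CARD('n) div (int r + 1) + int d - 2 - (int d - 2) div (int r + 1)"

text \<open>The projective space of \<open>'a ^ 'm\<close>; \<open>PG(3,q)\<close> is the instance \<open>'a ^ 4\<close>.\<close>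

definition pg_points :: "('a::field ^ 'm::finite) set set" where
  "pg_points = {P. vec.subspace P \<and> vec.dim P = 1}"

definition pg_lines :: "('a::field ^ 'm::finite) set set set" where
  "pg_lines = {{P \<in> pg_points. P \<subseteq> U} | U. vec.subspace U \<and> vec.dim U = 2}"

definition pg_collinear :: "('a::field ^ 'm::finite) set \<Rightarrow> ('a ^ 'm) set \<Rightarrow> ('a ^ 'm) set \<Rightarrow> bool" where
  "pg_collinear P Q R \<longleftrightarrow> (\<exists>M\<in>pg_lines. P \<in> M \<and> Q \<in> M \<and> R \<in> M)"

end

theory Submission imports Defs begin

text \<open>
  Let \<open>h\<^sub>1, \<dots>, h\<^sub>l\<close> be dual words whose supports are the repair groups, and let \<open>W\<close> be the code they
  check; it has dimension \<open>2l\<close> and is the direct sum of the \<open>2\<close>-dimensional codes \<open>W\<^sub>i\<close> of words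
  supported on the \<open>i\<close>-th group. A code \<open>C \<subseteq> W\<close> has \<open>n - k = l + 4\<close> iff it is the kernel on \<open>W\<close> of a
  surjective linear map \<open>\<phi>\<close> onto \<open>F\<^sup>4\<close>. The lines are \<open>\<phi>(W\<^sub>i)\<close>, and the three points on the \<open>i\<close>-th line
  are the images of the words of \<open>W\<^sub>i\<close> that vanish at one of the three coordinates of the group.
  A nonzero word of \<open>W\<close> has weight \<open>2\<close> or \<open>3\<close> on every group it meets, so weight at most \<open>6\<close> leaves one
  group, two groups, or three groups with weight \<open>2\<close> on each. Excluding these for words of \<open>C\<close>
  means that \<open>\<phi>\<close> is injective on \<open>W\<^sub>i\<close>, that the lines are skew, and that the points are in general
  position.
\<close>

section \<open>Linear algebra and projective geometry\<close>

lemma vec_rank_nullity: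
  fixes f :: "'a::field ^ 'n::finite \<Rightarrow> 'a ^ 'm::finite"
  assumes lin: "Vector_Spaces.linear (*s) (*s) f" and S: "vec.subspace S"
  shows "vec.dim S = vec.dim {x \<in> S. f x = 0} + vec.dim (f ` S)"
proof -
  interpret f: Vector_Spaces.linear "(*s)" "(*s)" f by (rule lin)
  define K where "K = {x \<in> S. f x = 0}"
  have K: "vec.subspace K"
    using S unfolding K_def vec.subspace_def by (auto simp: f.add f.scale f.zero)
  obtain B where B: "B \<subseteq> K" "vec.independent B" "K \<subseteq> vec.span B" "card B = vec.dim K"
    using vec.basis_exists by blast
  have BS: "B \<subseteq> S" using B K_def by auto
  obtain D where D: "B \<subseteq> D" "D \<subseteq> S" "vec.independent D" "S \<subseteq> vec.span D"
    using vec.maximal_independent_subset_extend[OF BS B(2)] by blast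
  have finD: "finite D" using D(3) by (rule vec.finiteI_independent)
  have spD: "vec.span D = S" using D S by (simp add: vec.span_minimal subset_antisym)
  have spB: "vec.span B = K" using B K by (simp add: vec.span_minimal subset_antisym)
  define E where "E = D - B"
  have DE: "D = B \<union> E" "B \<inter> E = {}" using D(1) E_def by auto
  have indE: "vec.independent E" using D(3) E_def vec.independent_mono by blast
  have disj: "vec.span B \<inter> vec.span E = {0}"
  proof -
    have "x = 0" if xB: "x \<in> vec.span B" and xE: "x \<in> vec.span E" for x
    proof -
      have fB: "finite B" and fE: "finite E" using finD DE by auto
      obtain u where u: "x = (\<Sum>b\<in>B. u b *s b)" using xB vec.span_finite[OF fB] by auto
      obtain v where v: "x = (\<Sum>b\<in>E. v b *s b)" using xE vec.span_finite[OF fE] by auto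
      \<comment> \<open>The sign change on \<open>E\<close> merges the two expansions of
        \<open>x\<close> into one vanishing combination over the independent set
        \<open>D\<close>.\<close>
      define w where "w b = (if b \<in> B then u b else - v b)" for b
      have "(\<Sum>b\<in>D. w b *s b) = (\<Sum>b\<in>B. w b *s b) + (\<Sum>b\<in>E. w b *s b)"
        unfolding DE(1) by (rule sum.union_disjoint) (use fB fE DE in auto)
      also have "(\<Sum>b\<in>B. w b *s b) = x" unfolding u by (rule sum.cong) (auto simp: w_def)
      also have "(\<Sum>b\<in>E. w b *s b) = (\<Sum>b\<in>E. - (v b *s b))"
        by (rule sum.cong) (use DE(2) in \<open>auto simp: w_def\<close>)
      also have "x + \<dots> = 0" using v by (simp add: sum_negf)
      finally have "\<And>b. b \<in> D \<Longrightarrow> w b = 0"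
        using D(3) finD vec.independentD by blast
      then have "\<And>b. b \<in> B \<Longrightarrow> u b = 0" using DE w_def by (metis UnI1)
      then show "x = 0" using u by simp
    qed
    then show ?thesis by (auto simp: vec.span_zero)
  qed
  have inj: "inj_on f (vec.span E)"
  proof (rule inj_onI)
    fix x y assume xy: "x \<in> vec.span E" "y \<in> vec.span E" "f x = f y"
    then have E: "x - y \<in> vec.span E" by (simp add: vec.span_diff)
    have "vec.span E \<subseteq> S" using vec.span_mono[of E D] DE(1) spD by blast
    then have "x - y \<in> vec.span B" using E xy(3) f.diff[of x y] K_def spB by auto
    then have "x - y = 0" using disj E by blast
    then show "x = y" by simp
  qed
  have "f ` S = vec.span (f ` D)" using f.span_image[of D] spD by simp
  also have "\<dots> = vec.span (f ` E)"
  proof (rule subset_antisym)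
    have "f ` B \<subseteq> {0}" using B(1) K_def by auto
    then have "f ` D \<subseteq> insert 0 (f ` E)" unfolding DE(1) by auto
    then have "vec.span (f ` D) \<subseteq> vec.span (insert 0 (f ` E))" by (rule vec.span_mono)
    then show "vec.span (f ` D) \<subseteq> vec.span (f ` E)" by (simp only: vec.span_insert_0)
  qed (use DE(1) in \<open>auto intro!: vec.span_mono\<close>)
  finally have "vec.dim (f ` S) = vec.dim E"
    by (simp only: vec.dim_span vec.dim_image_eq[OF lin inj])
  also have "\<dots> = card E" using indE by (rule vec.dim_eq_card_independent)
  finally have "vec.dim (f ` S) = card E" .
  moreover have "vec.dim S = card D" using vec.dim_span_eq_card_independent[OF D(3)] spD by simp
  moreover have "card D = card B + card E"
    using DE finD by (simp add: card_Un_disjoint)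
  ultimately show ?thesis using B(4) K_def by simp
qed

lemma vec_dim_image_trivial_kernel:
  fixes f :: "'a::field ^ 'n::finite \<Rightarrow> 'a ^ 'm::finite"
  assumes lin: "Vector_Spaces.linear (*s) (*s) f" and S: "vec.subspace S"
    and ker: "\<And>x. x \<in> S \<Longrightarrow> f x = 0 \<Longrightarrow> x = 0"
  shows "vec.dim (f ` S) = vec.dim S"
proof -
  have "{x \<in> S. f x = 0} \<subseteq> {0}" using ker by blast
  then have "vec.dim {x \<in> S. f x = 0} = 0" by (simp only: vec.dim_eq_0)
  then show ?thesis using vec_rank_nullity[OF lin S] by simp
qed

text \<open>A basis of \<open>A\<close> is sent to \<open>0\<close>, and the vectors that complete
  it to a basis of \<open>S\<close> are sent bijectively to the unit vectors. With \<open>S\<close>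
  the words checked by the repair groups and \<open>A\<close> the code, this yields the map
  \<open>\<phi>\<close> onto \<open>F\<^sup>4\<close>.\<close>

lemma linear_map_with_kernel:
  fixes S A :: "('a::field ^ 'n::finite) set"
  assumes S: "vec.subspace S" and A: "vec.subspace A" "A \<subseteq> S"
    and dim: "vec.dim S = vec.dim A + CARD('m::finite)"
  obtains f :: "'a ^ 'n \<Rightarrow> 'a ^ 'm" where "Vector_Spaces.linear (*s) (*s) f"
    and "\<And>x. x \<in> S \<Longrightarrow> f x = 0 \<longleftrightarrow> x \<in> A"
proof -
  obtain B where B: "B \<subseteq> A" "vec.independent B" "A \<subseteq> vec.span B" "card B = vec.dim A"
    using vec.basis_exists by blast
  have BS: "B \<subseteq> S" using B A by auto
  obtain D where D: "B \<subseteq> D" "D \<subseteq> S" "vec.independent D" "S \<subseteq> vec.span D"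
    using vec.maximal_independent_subset_extend[OF BS B(2)] by blast
  have finD: "finite D" using D(3) by (rule vec.finiteI_independent)
  have spD: "vec.span D = S" using D S by (simp add: vec.span_minimal subset_antisym)
  have spB: "vec.span B = A" using B A by (simp add: vec.span_minimal subset_antisym)
  have "card D = vec.dim S" using vec.dim_span_eq_card_independent[OF D(3)] spD by simp
  then have "card (D - B) = card (cart_basis :: ('a ^ 'm) set)"
    using D(1) finD dim B(4) by (simp add: card_Diff_subset[OF finite_subset[OF D(1) finD]] card_cart_basis)
  then obtain g where g: "bij_betw g (D - B) (cart_basis :: ('a ^ 'm) set)"
    using finD finite_cart_basis by (metis finite_Diff finite_same_card_bij)
  obtain f where lin: "Vector_Spaces.linear (*s) (*s) f"
    and f: "\<forall>x\<in>D. f x = (if x \<in> B then 0 else g x)"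
    using vec.linear_independent_extend[OF D(3), where f = "\<lambda>x. if x \<in> B then 0 else g x"] by blast
  interpret f: Vector_Spaces.linear "(*s)" "(*s)" f by (rule lin)
  define K where "K = {x \<in> S. f x = 0}"
  have K: "vec.subspace K"
    using S unfolding K_def vec.subspace_def by (auto simp: f.add f.scale f.zero)
  have "B \<subseteq> K" using f D BS unfolding K_def by auto
  then have AK: "A \<subseteq> K" using spB K vec.span_minimal by blast
  \<comment> \<open>Surjectivity fixes the dimension of the kernel in \<open>S\<close>; since the
    kernel contains \<open>A\<close> and has the same dimension, the two agree.\<close>
  have "cart_basis \<subseteq> f ` S"
  proof -
    have "cart_basis = f ` (D - B)" using g f unfolding bij_betw_def by auto
    then show ?thesis using D(2) by auto
  qed
  then have "f ` S = UNIV"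
    using span_cart_basis f.subspace_image[OF S] vec.span_minimal by blast
  then have "vec.dim S = vec.dim K + CARD('m)"
    using vec_rank_nullity[OF lin S] K_def by (simp add: card_cart_basis)
  then have "A = K" using vec.subspace_dim_equal[OF A(1) K AK] dim by simp
  then show ?thesis using that[OF lin] K_def by auto
qed

text \<open>The required space is spanned by a set of \<open>d\<close> vectors between a basis of
  the span of \<open>S\<close> and a basis of the whole space. It supplies a plane through two
  vectors even when they are proportional.\<close>

lemma subspace_of_dim_above:
  fixes S :: "('a::field ^ 'n::finite) set"
  assumes "vec.dim S \<le> d" and "d \<le> CARD('n)"
  obtains U where "vec.subspace U" "vec.dim U = d" "S \<subseteq> U"
proof -
  obtain B where B: "B \<subseteq> S" "vec.independent B" "S \<subseteq> vec.span B" "card B = vec.dim S"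
    using vec.basis_exists by blast
  obtain D where D: "B \<subseteq> D" "vec.independent D" "UNIV \<subseteq> vec.span D"
    by (rule vec.maximal_independent_subset_extend[OF subset_UNIV B(2)])
  have finD: "finite D" using D(2) by (rule vec.finiteI_independent)
  have "card D = CARD('n)"
    using D by (metis UNIV_I subsetI subset_antisym vec.dim_span_eq_card_independent vec_dim_card)
  then obtain E where E: "B \<subseteq> E" "E \<subseteq> D" "card E = d"
    using exists_subset_between[of B d D] B(4) assms D(1) finD by metis
  have "vec.independent E" using D(2) E(2) vec.independent_mono by blast
  then have "vec.dim (vec.span E) = d" using E(3) vec.dim_span_eq_card_independent by metis
  moreover have "S \<subseteq> vec.span E" using B(3) vec.span_mono[OF E(1)] by blast
  ultimately show ?thesis using that vec.subspace_span by metis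
qed

section \<open>Projective points and collinearity in terms of vectors\<close>

lemma dim_1_generator:
  fixes P :: "('a::field ^ 'n::finite) set"
  assumes "vec.subspace P" "vec.dim P = 1"
  obtains p where "p \<noteq> 0" "P = vec.span {p}"
proof -
  obtain B where B: "B \<subseteq> P" "vec.independent B" "P \<subseteq> vec.span B" "card B = 1"
    using vec.basis_exists assms by metis
  obtain p where p: "B = {p}" using B(4) by (auto simp: card_1_singleton_iff)
  have "p \<noteq> 0" using B(2) p by simp
  moreover have "P = vec.span {p}" using B p assms by (simp add: vec.span_minimal subset_antisym)
  ultimately show ?thesis using that by blast
qed

lemma dim_1_span:
  fixes P :: "('a::field ^ 'n::finite) set"
  assumes "vec.subspace P" "vec.dim P = 1" "p \<in> P" "p \<noteq> 0"
  shows "P = vec.span {p}"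
proof -
  have "vec.span {p} \<subseteq> P" using assms by (simp add: vec.span_minimal)
  moreover have "vec.dim (vec.span {p}) = 1" using assms by simp
  ultimately show ?thesis using vec.subspace_dim_equal assms vec.subspace_span
    by (metis le_refl)
qed

text \<open>Three vectors in a plane are dependent. The coefficients are absorbed into the vectors,
  which is harmless because points are closed under scaling; some of the vectors may still be
  \<open>0\<close>.\<close>

lemma pg_collinear_relation:
  fixes P Q R :: "('a::field ^ 'm::finite) set"
  assumes "pg_collinear P Q R"
  obtains a b c where "a \<in> P" "b \<in> Q" "c \<in> R" "a + b + c = 0" "\<not> (a = 0 \<and> b = 0 \<and> c = 0)"
proof -
  obtain U where U: "vec.subspace U" "vec.dim U = 2"
    and PQR: "P \<in> pg_points" "P \<subseteq> U" "Q \<in> pg_points" "Q \<subseteq> U" "R \<in> pg_points" "R \<subseteq> U"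
    using assms unfolding pg_collinear_def pg_lines_def by auto
  obtain p where p: "p \<noteq> 0" "P = vec.span {p}"
    using dim_1_generator[of P] PQR unfolding pg_points_def by auto
  obtain q where q: "q \<noteq> 0" "Q = vec.span {q}"
    using dim_1_generator[of Q] PQR unfolding pg_points_def by auto
  obtain r where r: "r \<noteq> 0" "R = vec.span {r}"
    using dim_1_generator[of R] PQR unfolding pg_points_def by auto
  have sc: "x *s p \<in> P" "x *s q \<in> Q" "x *s r \<in> R" for x
    using p q r by (auto simp: vec.span_base vec.span_scale)
  have sc1: "p \<in> P" "q \<in> Q" "r \<in> R" "0 \<in> P" "0 \<in> Q" "0 \<in> R"
    using p q r by (auto simp: vec.span_base vec.span_zero)
  have neg: "- q \<in> Q" "- r \<in> R" using sc[of "-1"] by auto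
  \<comment> \<open>If two generators coincide, \<open>{p, q, r}\<close> has fewer than three
    elements and the cardinality argument fails; the relation is then the difference of the equal
    generators.\<close>
  consider "p = q" | "p = r" | "q = r" | "p \<noteq> q" "p \<noteq> r" "q \<noteq> r" by blast
  then show ?thesis
  proof cases
    case 1 then show ?thesis using that[of p "- q" 0] sc1 neg p by simp
  next
    case 2 then show ?thesis using that[of p 0 "- r"] sc1 neg p by simp
  next
    case 3 then show ?thesis using that[of 0 q "- r"] sc1 neg q by simp
  next
    case 4
    have "{p, q, r} \<subseteq> U" using sc1 PQR by auto
    moreover have "card {p, q, r} = 3" using 4 by simp
    ultimately have "vec.dependent {p, q, r}"
      using vec.independent_card_le_dim[of "{p,q,r}" U] U(2) by auto
    then obtain u where u: "\<exists>v\<in>{p,q,r}. u v \<noteq> 0" "(\<Sum>v\<in>{p,q,r}. u v *s v) = 0"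
      using vec.dependent_finite[of "{p,q,r}"] by auto
    have "u p *s p + u q *s q + u r *s r = 0" using u(2) 4 by (simp add: add.assoc)
    moreover have "\<not> (u p *s p = 0 \<and> u q *s q = 0 \<and> u r *s r = 0)"
      using u(1) p q r by auto
    ultimately show ?thesis using that sc by blast
  qed
qed

lemma pg_collinear_in_plane:
  assumes "vec.subspace U" "vec.dim U = 2"
    and "P \<in> pg_points" "Q \<in> pg_points" "R \<in> pg_points" "P \<subseteq> U" "Q \<subseteq> U" "R \<subseteq> U"
  shows "pg_collinear P Q R"
proof -
  have "{X \<in> pg_points. X \<subseteq> U} \<in> pg_lines" unfolding pg_lines_def using assms(1,2) by auto
  then show ?thesis unfolding pg_collinear_def by (rule bexI[rotated]) (simp add: assms(3-))
qed

text \<open>A converse of \<open>pg_collinear_relation\<close> for non-zero vectors: each generates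
  its point, and the relation places \<open>c\<close> in every plane through \<open>a\<close> and
  \<open>b\<close>.\<close>

lemma pg_collinearI:
  fixes P Q R :: "('a::field ^ 'm::finite) set"
  assumes m: "2 \<le> CARD('m)" and PQR: "P \<in> pg_points" "Q \<in> pg_points" "R \<in> pg_points"
    and abc: "a \<in> P" "b \<in> Q" "c \<in> R" "a + b + c = 0" "a \<noteq> 0" "b \<noteq> 0" "c \<noteq> 0"
  shows "pg_collinear P Q R"
proof -
  have eq: "P = vec.span {a}" "Q = vec.span {b}" "R = vec.span {c}"
    using dim_1_span[of P a] dim_1_span[of Q b] dim_1_span[of R c] PQR abc
    unfolding pg_points_def by auto
  have "vec.dim {a, b} \<le> card {a, b}" by (rule vec.dim_le_card) (auto simp: vec.span_superset)
  also have "\<dots> \<le> 2" by (simp add: card_insert_if)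
  finally obtain U where U: "vec.subspace U" "vec.dim U = 2" "{a, b} \<subseteq> U"
    using subspace_of_dim_above m by metis
  have "c = - (a + b)" using abc(4) by (metis add.inverse_unique)
  then have "c \<in> U" using U by (metis insert_subset vec.subspace_add vec.subspace_neg)
  then have "P \<subseteq> U" "Q \<subseteq> U" "R \<subseteq> U"
    unfolding eq using U vec.span_minimal[OF _ U(1)] by blast+
  then show ?thesis by (rule pg_collinear_in_plane[OF U(1,2) PQR])
qed

section \<open>Configurations of skew lines\<close>

text \<open>A map onto \<open>F\<^sup>2\<close> with kernel \<open>V\<close> is injective on
  \<open>U\<close>, hence maps \<open>U\<close> onto \<open>F\<^sup>2\<close>, so some
  \<open>u\<close> in \<open>U\<close> has the same image as \<open>x\<close>. Geometrically, a
  point off two skew lines lies on a line that meets both.\<close>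

lemma complementary_planes:
  fixes U V :: "('a::field ^ 4) set"
  assumes U: "vec.subspace U" "vec.dim U = 2" and V: "vec.subspace V" "vec.dim V = 2"
    and disj: "U \<inter> V = {0}"
  obtains u v where "u \<in> U" "v \<in> V" "x = u + v"
proof -
  have "vec.dim (UNIV :: ('a ^ 4) set) = vec.dim V + CARD(2)" using V by (simp add: card_cart_basis)
  then obtain f :: "'a ^ 4 \<Rightarrow> 'a ^ 2" where lin: "Vector_Spaces.linear (*s) (*s) f"
    and f: "\<And>x. f x = 0 \<longleftrightarrow> x \<in> V"
    
    by (rule linear_map_with_kernel[OF vec.subspace_UNIV V(1) subset_UNIV]) simp
  interpret f: Vector_Spaces.linear "(*s)" "(*s)" f by (rule lin)
  have "{x \<in> U. f x = 0} = {0}" using f disj by auto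
  then have "vec.dim (f ` U) = 2" using vec_rank_nullity[OF lin U(1)] U(2) by simp
  then have "f ` U = UNIV"
    using vec.subspace_dim_equal[OF f.subspace_image[OF U(1)] vec.subspace_UNIV]
    by (simp add: card_cart_basis)
  then obtain u where u: "u \<in> U" "f x = f u" by (metis UNIV_I imageE)
  then have "x - u \<in> V" using f[of "x - u"] f.diff[of x u] by simp
  then show ?thesis using that[OF u(1), of "x - u"] by simp
qed

lemma trivial_Int_sum_eq_0:
  assumes "vec.subspace U" "vec.subspace V" "U \<inter> V = {0}" "a \<in> U" "b \<in> V" "a + b = 0"
  shows "a = 0" "b = 0"
proof -
  have "b = - a" using assms(6) by (metis add.inverse_unique)
  then have "b \<in> U" using assms(1,4) vec.subspace_neg by blast
  then show "b = 0" using assms(3,5) by blast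
  then show "a = 0" using assms(6) by simp
qed

section \<open>Configurations as planes of vectors\<close>

text \<open>Lines are represented by planes of vectors, and general position by the absence of
  three-term relations between non-zero vectors, because images of codewords are vectors and a word
  in the kernel gives such a relation. The indices are merely distinct rather than increasing, so
  that any three groups can be inserted directly.\<close>

definition line_config ::
    "(nat \<Rightarrow> ('a::field ^ 'm::finite) set) \<Rightarrow> (nat \<Rightarrow> nat \<Rightarrow> ('a ^ 'm) set) \<Rightarrow> nat \<Rightarrow> bool" where
  "line_config U P l \<longleftrightarrow>
     (\<forall>i\<in>{1..l}. vec.subspace (U i) \<and> vec.dim (U i) = 2 \<and> inj_on (P i) {1..3} \<and>
        (\<forall>\<mu>\<in>{1..3}. P i \<mu> \<in> pg_points \<and> P i \<mu> \<subseteq> U i)) \<and>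
     (\<forall>i\<in>{1..l}. \<forall>j\<in>{1..l}. i \<noteq> j \<longrightarrow> U i \<inter> U j = {0}) \<and>
     (\<forall>i\<in>{1..l}. \<forall>j\<in>{1..l}. \<forall>m\<in>{1..l}. i \<noteq> j \<longrightarrow> i \<noteq> m \<longrightarrow> j \<noteq> m \<longrightarrow>
        (\<forall>\<mu>\<in>{1..3}. \<forall>\<nu>\<in>{1..3}. \<forall>\<omega>\<in>{1..3}.
           \<forall>a\<in>P i \<mu> - {0}. \<forall>b\<in>P j \<nu> - {0}. \<forall>c\<in>P m \<omega> - {0}. a + b + c \<noteq> 0))"

lemma line_configD:
  assumes "line_config U P l" "i \<in> {1..l}"
  shows "vec.subspace (U i)" "vec.dim (U i) = 2" "inj_on (P i) {1..3}"
    and "\<mu> \<in> {1..3} \<Longrightarrow> P i \<mu> \<in> pg_points" "\<mu> \<in> {1..3} \<Longrightarrow> P i \<mu> \<subseteq> U i"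
    and "j \<in> {1..l} \<Longrightarrow> i \<noteq> j \<Longrightarrow> U i \<inter> U j = {0}"
proof -
  have "\<forall>i\<in>{1..l}. vec.subspace (U i) \<and> vec.dim (U i) = 2 \<and> inj_on (P i) {1..3} \<and>
        (\<forall>\<mu>\<in>{1..3}. P i \<mu> \<in> pg_points \<and> P i \<mu> \<subseteq> U i)"
    using assms(1) unfolding line_config_def by (rule conjunct1)
  from bspec[OF this assms(2)]
  show "vec.subspace (U i)" "vec.dim (U i) = 2" "inj_on (P i) {1..3}"
    "\<mu> \<in> {1..3} \<Longrightarrow> P i \<mu> \<in> pg_points" "\<mu> \<in> {1..3} \<Longrightarrow> P i \<mu> \<subseteq> U i" by blast+
  have "\<forall>i\<in>{1..l}. \<forall>j\<in>{1..l}. i \<noteq> j \<longrightarrow> U i \<inter> U j = {0}"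
    using assms(1) unfolding line_config_def by (elim conjE)
  then show "j \<in> {1..l} \<Longrightarrow> i \<noteq> j \<Longrightarrow> U i \<inter> U j = {0}" using assms(2) by blast
qed

lemma line_config_indep:
  assumes "line_config U P l" "i \<in> {1..l}" "j \<in> {1..l}" "m \<in> {1..l}" "i \<noteq> j" "i \<noteq> m" "j \<noteq> m"
    and "\<mu> \<in> {1..3}" "\<nu> \<in> {1..3}" "\<omega> \<in> {1..3}"
    and "a \<in> P i \<mu> - {0}" "b \<in> P j \<nu> - {0}" "c \<in> P m \<omega> - {0}"
  shows "a + b + c \<noteq> 0"
proof -
  have "\<forall>i\<in>{1..l}. \<forall>j\<in>{1..l}. \<forall>m\<in>{1..l}. i \<noteq> j \<longrightarrow> i \<noteq> m \<longrightarrow> j \<noteq> m \<longrightarrow>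
        (\<forall>\<mu>\<in>{1..3}. \<forall>\<nu>\<in>{1..3}. \<forall>\<omega>\<in>{1..3}.
           \<forall>a\<in>P i \<mu> - {0}. \<forall>b\<in>P j \<nu> - {0}. \<forall>c\<in>P m \<omega> - {0}. a + b + c \<noteq> 0)"
    using assms(1) unfolding line_config_def by (elim conjE)
  from this[rule_format, OF assms(2-)] show ?thesis .
qed

lemma line_configI:
  assumes "\<And>i. i \<in> {1..l} \<Longrightarrow> vec.subspace (U i)" "\<And>i. i \<in> {1..l} \<Longrightarrow> vec.dim (U i) = 2"
    and "\<And>i. i \<in> {1..l} \<Longrightarrow> inj_on (P i) {1..3}"
    and "\<And>i \<mu>. i \<in> {1..l} \<Longrightarrow> \<mu> \<in> {1..3} \<Longrightarrow> P i \<mu> \<in> pg_points"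
    and "\<And>i \<mu>. i \<in> {1..l} \<Longrightarrow> \<mu> \<in> {1..3} \<Longrightarrow> P i \<mu> \<subseteq> U i"
    and "\<And>i j. i \<in> {1..l} \<Longrightarrow> j \<in> {1..l} \<Longrightarrow> i \<noteq> j \<Longrightarrow> U i \<inter> U j = {0}"
    and "\<And>i j m \<mu> \<nu> \<omega> a b c. i \<in> {1..l} \<Longrightarrow> j \<in> {1..l} \<Longrightarrow> m \<in> {1..l} \<Longrightarrow> i \<noteq> j \<Longrightarrow> i \<noteq> m \<Longrightarrow> j \<noteq> m
      \<Longrightarrow> \<mu> \<in> {1..3} \<Longrightarrow> \<nu> \<in> {1..3} \<Longrightarrow> \<omega> \<in> {1..3}
      \<Longrightarrow> a \<in> P i \<mu> - {0} \<Longrightarrow> b \<in> P j \<nu> - {0} \<Longrightarrow> c \<in> P m \<omega> - {0} \<Longrightarrow> a + b + c \<noteq> 0"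
  shows "line_config U P l"
  unfolding line_config_def
  by (intro conjI ballI impI) (fact assms)+

lemma pg_points_span: "x \<noteq> 0 \<Longrightarrow> vec.span {x} \<in> pg_points"
  unfolding pg_points_def by simp

lemma pg_collinear_commute:
  "pg_collinear P Q R \<Longrightarrow> pg_collinear Q P R" "pg_collinear P Q R \<Longrightarrow> pg_collinear P R Q"
  unfolding pg_collinear_def by auto

text \<open>Skewness agrees on both sides because a common non-zero vector of two planes spans a
  common point. Non-collinearity agrees with the absence of relations because, on pairwise skew
  lines, a relation obtained from collinear points has three non-zero terms.\<close>

lemma line_config_iff:
  "(\<exists>(U :: nat \<Rightarrow> ('a ^ 'm) set) P. line_config U P l) \<longleftrightarrow>
     (\<exists>L :: nat \<Rightarrow> ('a::field ^ 'm::finite) set set.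
          (\<forall>i\<in>{1..l}. L i \<in> pg_lines) \<and>
          (\<forall>i\<in>{1..l}. \<forall>j\<in>{1..l}. i \<noteq> j \<longrightarrow> L i \<inter> L j = {}) \<and>
          (\<exists>P :: nat \<Rightarrow> nat \<Rightarrow> ('a ^ 'm) set.
             (\<forall>i\<in>{1..l}. inj_on (P i) {1..3} \<and> (\<forall>\<mu>\<in>{1..3}. P i \<mu> \<in> L i)) \<and>
             (\<forall>s t m. 1 \<le> s \<and> s < t \<and> t < m \<and> m \<le> l \<longrightarrow>
                (\<forall>\<mu>\<in>{1..3}. \<forall>\<nu>\<in>{1..3}. \<forall>\<omega>\<in>{1..3}.
                   \<not> pg_collinear (P s \<mu>) (P t \<nu>) (P m \<omega>)))))"
  (is "?config \<longleftrightarrow> (\<exists>L. ?lines L \<and> ?skew L \<and> (\<exists>P. ?points L P \<and> ?general P))")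
proof
  assume ?config
  then obtain U and P :: "nat \<Rightarrow> nat \<Rightarrow> ('a ^ 'm) set" where c: "line_config U P l" by blast
  define L where "L i = {X \<in> pg_points. X \<subseteq> U i}" for i
  have U: "vec.subspace (U i)" "vec.dim (U i) = 2" "inj_on (P i) {1..3}" if "i \<in> {1..l}" for i
    using line_configD[OF c] that by blast+
  have P: "P i \<mu> \<in> pg_points" "P i \<mu> \<subseteq> U i" if "i \<in> {1..l}" "\<mu> \<in> {1..3}" for i \<mu>
    using line_configD[OF c] that by blast+
  have disj: "U i \<inter> U j = {0}" if "i \<in> {1..l}" "j \<in> {1..l}" "i \<noteq> j" for i j
    using line_configD(6)[OF c] that by blast
  have "?lines L" using U unfolding L_def pg_lines_def by blast
  moreover have "?skew L"
  proof (intro ballI impI)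
    fix i j assume ij: "i \<in> {1..l}" "j \<in> {1..l}" "i \<noteq> j"
    have False if X: "X \<in> L i" "X \<in> L j" for X
    proof -
      have "X \<subseteq> {0}" using X disj[OF ij] unfolding L_def by auto
      moreover have "vec.dim X = 1" using X unfolding L_def pg_points_def by simp
      ultimately show False using vec.dim_eq_0[of X] by presburger
    qed
    then show "L i \<inter> L j = {}" by blast
  qed
  moreover have "?points L P" using U P unfolding L_def by blast
  moreover have "?general P"
  proof (intro allI impI ballI notI)
    fix i j m \<mu> \<nu> \<omega>
    assume ord: "1 \<le> i \<and> i < j \<and> j < m \<and> m \<le> l"
      and \<mu>: "\<mu> \<in> {1..3}" and \<nu>: "\<nu> \<in> {1..3}" and \<omega>: "\<omega> \<in> {1..3}"
      and "pg_collinear (P i \<mu>) (P j \<nu>) (P m \<omega>)"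
    then obtain x y z where xyz: "x \<in> P i \<mu>" "y \<in> P j \<nu>" "z \<in> P m \<omega>" "x + y + z = 0"
      and nz: "\<not> (x = 0 \<and> y = 0 \<and> z = 0)"
      using pg_collinear_relation by metis
    have ijm: "i \<in> {1..l}" "j \<in> {1..l}" "m \<in> {1..l}" "i \<noteq> j" "i \<noteq> m" "j \<noteq> m" using ord by auto
    have mem: "x \<in> U i" "y \<in> U j" "z \<in> U m" using xyz P ijm \<mu> \<nu> \<omega> by blast+
    \<comment> \<open>If one vector were \<open>0\<close>, the other two would cancel across two
      planes that meet only in \<open>0\<close>, so all three would vanish.\<close>
    have "x \<noteq> 0"
      using trivial_Int_sum_eq_0[OF U(1) U(1) disj mem(2,3)] ijm xyz(4) nz by auto
    moreover have "y \<noteq> 0"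
      using trivial_Int_sum_eq_0[OF U(1) U(1) disj mem(1,3)] ijm xyz(4) nz by auto
    moreover have "z \<noteq> 0"
      using trivial_Int_sum_eq_0[OF U(1) U(1) disj mem(1,2)] ijm xyz(4) nz by auto
    ultimately show False
      using line_config_indep[OF c ijm \<mu> \<nu> \<omega>, of x y z] xyz by simp
  qed
  ultimately show "\<exists>L. ?lines L \<and> ?skew L \<and> (\<exists>P. ?points L P \<and> ?general P)"
    by (intro exI[of _ L] exI[of _ P] conjI)
next
  assume "\<exists>L. ?lines L \<and> ?skew L \<and> (\<exists>P. ?points L P \<and> ?general P)"
  then obtain L P where LP: "?lines L" "?skew L" "?points L P" "?general P"
    by (elim exE conjE)
  from LP(1) have "\<forall>i\<in>{1..l}. \<exists>U. L i = {X \<in> pg_points. X \<subseteq> U} \<and> vec.subspace U \<and> vec.dim U = 2"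
    unfolding pg_lines_def by blast
  from bchoice[OF this] obtain U where U': "\<forall>i\<in>{1..l}. L i = {X \<in> pg_points. X \<subseteq> U i} \<and>
     vec.subspace (U i) \<and> vec.dim (U i) = 2" ..
  have U: "L i = {X \<in> pg_points. X \<subseteq> U i}" "vec.subspace (U i)" "vec.dim (U i) = 2"
    if "i \<in> {1..l}" for i using bspec[OF U' that] by blast+
  have P: "P i \<mu> \<in> pg_points" "P i \<mu> \<subseteq> U i" if "i \<in> {1..l}" "\<mu> \<in> {1..3}" for i \<mu>
    using bspec[OF LP(3) that(1)] U(1)[OF that(1)] that(2) by auto
  have disj: "U i \<inter> U j = {0}" if ij: "i \<in> {1..l}" "j \<in> {1..l}" "i \<noteq> j" for i j
  proof -
    have "x = 0" if x: "x \<in> U i" "x \<in> U j" for x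
    proof (rule ccontr)
      assume "x \<noteq> 0"
      then have "vec.span {x} \<in> pg_points" by (rule pg_points_span)
      moreover have "vec.span {x} \<subseteq> U i" "vec.span {x} \<subseteq> U j"
        using x U(2)[OF ij(1)] U(2)[OF ij(2)] by (simp_all add: vec.span_minimal)
      ultimately have "vec.span {x} \<in> L i \<inter> L j" using U(1)[OF ij(1)] U(1)[OF ij(2)] by simp
      then show False using LP(2)[rule_format, OF ij] by simp
    qed
    then show ?thesis using vec.subspace_0[OF U(2)] ij by auto
  qed
  have general: "\<not> pg_collinear (P i \<mu>) (P j \<nu>) (P m \<omega>)"
    if ijm: "i \<in> {1..l}" "j \<in> {1..l}" "m \<in> {1..l}" "i \<noteq> j" "i \<noteq> m" "j \<noteq> m"
      and range: "\<mu> \<in> {1..3}" "\<nu> \<in> {1..3}" "\<omega> \<in> {1..3}" for i j m \<mu> \<nu> \<omega>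
  proof
    \<comment> \<open>The geometric condition speaks only of increasing indices; symmetry of
      collinearity carries it over to the six possible orders.\<close>
    have sorted: "\<not> pg_collinear (P i \<mu>) (P j \<nu>) (P m \<omega>)"
      if "i < j" "j < m" "i \<in> {1..l}" "m \<in> {1..l}" "\<mu> \<in> {1..3}" "\<nu> \<in> {1..3}" "\<omega> \<in> {1..3}"
      for i j m \<mu> \<nu> \<omega>
      using LP(4)[rule_format, of i j m \<mu> \<nu> \<omega>] that by simp
    assume col: "pg_collinear (P i \<mu>) (P j \<nu>) (P m \<omega>)"
    consider "i < j" "j < m" | "i < m" "m < j" | "j < i" "i < m" | "j < m" "m < i"
      | "m < i" "i < j" | "m < j" "j < i" using ijm by linarith
    then show False
    proof cases
      case 1 then show False using sorted ijm range col by blast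
    next
      case 2 then show False using sorted[OF 2] ijm range col pg_collinear_commute by blast
    next
      case 3 then show False using sorted[OF 3] ijm range col pg_collinear_commute by blast
    next
      case 4
      have "pg_collinear (P j \<nu>) (P m \<omega>) (P i \<mu>)" using col pg_collinear_commute by blast
      then show False using sorted[OF 4] ijm range by blast
    next
      case 5
      have "pg_collinear (P m \<omega>) (P i \<mu>) (P j \<nu>)" using col pg_collinear_commute by blast
      then show False using sorted[OF 5] ijm range by blast
    next
      case 6
      have "pg_collinear (P m \<omega>) (P i \<mu>) (P j \<nu>)" using col pg_collinear_commute by blast
      then have "pg_collinear (P m \<omega>) (P j \<nu>) (P i \<mu>)" by (rule pg_collinear_commute)
      then show False using sorted[OF 6] ijm range by blast
    qed
  qed
  have indep: "a + b + c \<noteq> 0"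
    if ijm: "i \<in> {1..l}" "j \<in> {1..l}" "m \<in> {1..l}" "i \<noteq> j" "i \<noteq> m" "j \<noteq> m"
      and range: "\<mu> \<in> {1..3}" "\<nu> \<in> {1..3}" "\<omega> \<in> {1..3}"
      and abc: "a \<in> P i \<mu> - {0}" "b \<in> P j \<nu> - {0}" "c \<in> P m \<omega> - {0}"
    for i j m \<mu> \<nu> \<omega> a b c
  proof
    assume "a + b + c = 0"
    moreover have "2 \<le> CARD('m)"
      using vec.dim_subset[OF subset_UNIV, of "U i"] U(3)[OF ijm(1)] by (simp add: card_cart_basis)
    ultimately have "pg_collinear (P i \<mu>) (P j \<nu>) (P m \<omega>)"
      using pg_collinearI[of "P i \<mu>" "P j \<nu>" "P m \<omega>" a b c] P(1) ijm range abc by simp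
    then show False using general[OF ijm range] by simp
  qed
  have inj: "inj_on (P i) {1..3}" if "i \<in> {1..l}" for i using bspec[OF LP(3) that] by blast
  have "line_config U P l" by (rule line_configI) (fact U inj P disj indep)+
  then show ?config by blast
qed

text \<open>
  A relation \<open>a + b + r = 0\<close> of this shape is a codeword of weight at most \<open>2 + 2 + 3\<close>. The points given
  may have none: the code built from them then has minimum distance \<open>8\<close>, with the same
  \<open>n - k\<close>. In that case the line through \<open>P 2 1\<close> that meets \<open>U 1\<close> and \<open>U 3\<close> replaces \<open>P 1 1\<close> by its
  point on \<open>U 1\<close>; the absence of relations before the exchange keeps the points in general position.
\<close>

lemma line_config_with_relation:
  fixes U :: "nat \<Rightarrow> ('a::field ^ 4) set"
  assumes c: "line_config U P l" and l: "3 \<le> l"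
  obtains P' s t m \<mu> \<nu> a b r where "line_config U P' l"
    "s \<in> {1..l}" "t \<in> {1..l}" "m \<in> {1..l}" "s \<noteq> t" "s \<noteq> m" "t \<noteq> m"
    "\<mu> \<in> {1..3}" "\<nu> \<in> {1..3}" "a \<in> P' s \<mu> - {0}" "b \<in> P' t \<nu> - {0}" "r \<in> U m" "a + b + r = 0"
proof -
  define related where "related P' \<longleftrightarrow> (\<exists>s\<in>{1..l}. \<exists>t\<in>{1..l}. \<exists>m\<in>{1..l}. s \<noteq> t \<and> s \<noteq> m \<and> t \<noteq> m \<and>
    (\<exists>\<mu>\<in>{1..3}. \<exists>\<nu>\<in>{1..3}. \<exists>a\<in>P' s \<mu> - {0}. \<exists>b\<in>P' t \<nu> - {0}. \<exists>r\<in>U m. a + b + r = 0))"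
    for P' :: "nat \<Rightarrow> nat \<Rightarrow> ('a ^ 4) set"
  have "\<exists>P'. line_config U P' l \<and> related P'"
  proof (cases "related P")
    case True then show ?thesis using c by blast
  next
    case False
    have unrelated: "a + b + r \<noteq> 0"
      if "s \<in> {1..l}" "t \<in> {1..l}" "m \<in> {1..l}" "s \<noteq> t" "s \<noteq> m" "t \<noteq> m"
        "\<mu> \<in> {1..3}" "\<nu> \<in> {1..3}" "a \<in> P s \<mu> - {0}" "b \<in> P t \<nu> - {0}" "r \<in> U m"
      for s t m \<mu> \<nu> a b r
      using False that unfolding related_def by blast
    have U: "vec.subspace (U i)" "vec.dim (U i) = 2" "inj_on (P i) {1..3}" if "i \<in> {1..l}" for i
      using line_configD[OF c] that by blast+
    have P: "P i \<mu> \<in> pg_points" "P i \<mu> \<subseteq> U i" if "i \<in> {1..l}" "\<mu> \<in> {1..3}" for i \<mu>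
      using line_configD[OF c] that by blast+
    have disj: "U i \<inter> U j = {0}" if "i \<in> {1..l}" "j \<in> {1..l}" "i \<noteq> j" for i j
      using line_configD(6)[OF c] that by blast
    have i: "1 \<in> {1..l}" "2 \<in> {1..l}" "3 \<in> {1..l}" using l by auto
    have o: "1 \<in> {1..3::nat}" by simp
    have d: "U 1 \<inter> U 3 = {0}" "U 2 \<inter> U 3 = {0}" using disj[OF i(1,3)] disj[OF i(2,3)] by simp_all
    obtain p where p: "p \<noteq> 0" "P 2 1 = vec.span {p}"
      using dim_1_generator[of "P 2 1"] P(1)[OF i(2) o] unfolding pg_points_def by auto
    have p21: "p \<in> P 2 1" using p by (simp add: vec.span_base)
    then have pU: "p \<in> U 2" using P(2)[OF i(2) o] by blast
    \<comment> \<open>Splitting \<open>- p\<close> along \<open>U 1\<close> and \<open>U 3\<close>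
      gives the line through \<open>P 2 1\<close> that meets both: \<open>a\<close> and
      \<open>r\<close> represent its intersections with them.\<close>
    obtain a r where ar: "a \<in> U 1" "r \<in> U 3" "- p = a + r"
      using complementary_planes[OF U(1,2)[OF i(1)] U(1,2)[OF i(3)] d(1)] by auto
    have rel: "a + p + r = 0" "p + r + a = 0" using ar(3) by (metis add.assoc add.commute add.right_inverse)+
    have a0: "a \<noteq> 0"
      using trivial_Int_sum_eq_0(1)[OF U(1)[OF i(2)] U(1)[OF i(3)] d(2) pU ar(2)] rel p(1)
      by auto
    define Q where "Q = vec.span {a}"
    have Q: "Q \<in> pg_points" "Q \<subseteq> U 1"
      using a0 ar(1) U(1)[OF i(1)] by (auto simp: Q_def pg_points_span vec.span_minimal)
    have aQ: "a \<in> Q" by (simp add: Q_def vec.span_base)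
    \<comment> \<open>If the new point were already among the three on \<open>U 1\<close>, the
      relation \<open>a + p + r = 0\<close> would contradict \<open>unrelated\<close>. Hence the
      points on this line stay distinct after the exchange.\<close>
    have QP: "Q \<noteq> P 1 \<mu>" if "\<mu> \<in> {1..3}" for \<mu>
      using unrelated[OF i _ _ _ that o, of a p r] aQ a0 p21 p(1) ar(2) rel(1) by auto
    define P' where "P' i \<mu> = (if i = 1 \<and> \<mu> = 1 then Q else P i \<mu>)" for i \<mu>
    have inj': "inj_on (P' i) {1..3}" if "i \<in> {1..l}" for i
      using U(3)[OF that] QP unfolding inj_on_def P'_def by metis
    have P': "P' i \<mu> \<in> pg_points" "P' i \<mu> \<subseteq> U i" if "i \<in> {1..l}" "\<mu> \<in> {1..3}" for i \<mu>
      using P[OF that] Q unfolding P'_def by auto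
    have indep': "x + y + z \<noteq> 0"
      if ijm: "i \<in> {1..l}" "j \<in> {1..l}" "m \<in> {1..l}" "i \<noteq> j" "i \<noteq> m" "j \<noteq> m"
      and range: "\<mu> \<in> {1..3}" "\<nu> \<in> {1..3}" "\<omega> \<in> {1..3}"
      and xyz: "x \<in> P' i \<mu> - {0}" "y \<in> P' j \<nu> - {0}" "z \<in> P' m \<omega> - {0}"
      for i j m \<mu> \<nu> \<omega> x y z
    proof -
      \<comment> \<open>As \<open>i\<close>, \<open>j\<close>, \<open>m\<close> are distinct, at
        most one term comes from the new point \<open>Q\<close>. Its vector still lies in
        \<open>U 1\<close> and the other two belong to old points, so \<open>unrelated\<close>
        applies with \<open>Q\<close> in the role of the arbitrary plane vector.\<close>
      consider "i = 1 \<and> \<mu> = 1" | "j = 1 \<and> \<nu> = 1" | "m = 1 \<and> \<omega> = 1"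
        | "\<not> (i = 1 \<and> \<mu> = 1)" "\<not> (j = 1 \<and> \<nu> = 1)" "\<not> (m = 1 \<and> \<omega> = 1)" by blast
      then show ?thesis
      proof cases
        case 1
        then have "y \<in> P j \<nu> - {0}" "z \<in> P m \<omega> - {0}" "x \<in> U i"
          using xyz ijm Q(2) unfolding P'_def by auto
        then have "y + z + x \<noteq> 0" using unrelated[of j m i \<nu> \<omega> y z x] ijm range by auto
        then show ?thesis by (simp add: ac_simps)
      next
        case 2
        then have "x \<in> P i \<mu> - {0}" "z \<in> P m \<omega> - {0}" "y \<in> U j"
          using xyz ijm Q(2) unfolding P'_def by auto
        then have "x + z + y \<noteq> 0" using unrelated[of i m j \<mu> \<omega> x z y] ijm range by auto
        then show ?thesis by (simp add: ac_simps)
      next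
        case 3
        then have "x \<in> P i \<mu> - {0}" "y \<in> P j \<nu> - {0}" "z \<in> U m"
          using xyz ijm Q(2) unfolding P'_def by auto
        then show ?thesis using unrelated[of i j m \<mu> \<nu> x y z] ijm range by auto
      next
        case 4
        then have "x \<in> P i \<mu> - {0}" "y \<in> P j \<nu> - {0}" "z \<in> P m \<omega> - {0}"
          using xyz unfolding P'_def by auto
        then show ?thesis using line_config_indep[OF c ijm range] by blast
      qed
    qed
    have "line_config U P' l" by (rule line_configI) (fact U inj' P' disj indep')+
    moreover have "\<exists>\<mu>\<in>{1..3}. \<exists>\<nu>\<in>{1..3}. \<exists>a\<in>P' 1 \<mu> - {0}. \<exists>b\<in>P' 2 \<nu> - {0}. \<exists>r\<in>U 3. a + b + r = 0"
      using o aQ a0 p21 p(1) ar(2) rel(1)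
      by (intro bexI[of _ 1] bexI[of _ a] bexI[of _ p] bexI[of _ r]) (auto simp: P'_def)
    then have "related P'"
      unfolding related_def using i
      by (intro bexI[of _ 1] bexI[of _ 2] bexI[of _ 3]) auto
    ultimately show ?thesis by blast
  qed
  then obtain P' where "line_config U P' l" "related P'" by blast
  then show ?thesis using that unfolding related_def by blast
qed

section \<open>Words with disjoint repair groups\<close>

definition pairing :: "'a::field ^ 'n::finite \<Rightarrow> 'a ^ 'n \<Rightarrow> 'a" where
  "pairing h c = (\<Sum>i\<in>UNIV. h $ i * c $ i)"

lemma pairing_add: "pairing h (c + d) = pairing h c + pairing h d"
  by (simp add: pairing_def algebra_simps sum.distrib)

lemma pairing_scale: "pairing h (r *s c) = r * pairing h c"
  by (simp add: pairing_def sum_distrib_left algebra_simps)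

lemma pairing_0: "pairing h 0 = 0"
  by (simp add: pairing_def)

lemma pairing_supp: "pairing h c = (\<Sum>i\<in>supp h. h $ i * c $ i)"
  unfolding pairing_def by (rule sum.mono_neutral_right) (auto simp: supp_def)

lemma supp_empty_iff: "supp c = {} \<longleftrightarrow> c = 0"
  by (auto simp: supp_def vec_eq_iff)

lemma supp_0: "supp 0 = {}"
  by (simp add: supp_def)

lemma card_supp_add:
  fixes c d :: "'a::monoid_add ^ 'n::finite"
  shows "card (supp (c + d)) \<le> card (supp c) + card (supp d)"
proof -
  have "supp (c + d) \<subseteq> supp c \<union> supp d" by (auto simp: supp_def)
  then show ?thesis
    using card_mono[of "supp c \<union> supp d" "supp (c + d)"] card_Un_le[of "supp c" "supp d"] by simp
qed

lemma card_supp_diff: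
  fixes c d :: "'a::group_add ^ 'n::finite"
  shows "card (supp (c - d)) \<le> card (supp c) + card (supp d)"
proof -
  have "supp (- d) = supp d" by (simp add: supp_def)
  then show ?thesis using card_supp_add[of c "- d"] by simp
qed

lemma mem_dual_code: "h \<in> dual_code C \<longleftrightarrow> (\<forall>c\<in>C. pairing h c = 0)"
  by (simp add: dual_code_def pairing_def)

section \<open>The words checked by the repair groups and their decomposition\<close>

text \<open>The locale serves both directions: \<open>h\<close> consists of given dual codewords in
  one and of constructed all-one checks in the other. The total length makes the disjoint supports a
  partition of the coordinates.\<close>

locale repair_groups =
  fixes h :: "nat \<Rightarrow> 'a::{field,finite} ^ 'n::finite" and l :: nat
  assumes card_supp: "i \<in> {1..l} \<Longrightarrow> card (supp (h i)) = 3"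
    and disjoint: "i \<in> {1..l} \<Longrightarrow> j \<in> {1..l} \<Longrightarrow> i \<noteq> j \<Longrightarrow> supp (h i) \<inter> supp (h j) = {}"
    and length: "CARD('n) = 3 * l"
begin

text \<open>This is the code \<open>W\<close> of the overview. The next two definitions are its
  summands \<open>W\<^sub>i\<close>, padded with zeros to full length, and the restrictions that
  project onto them.\<close>

definition words :: "('a ^ 'n) set" where
  "words = {c. \<forall>i\<in>{1..l}. pairing (h i) c = 0}"

definition local_words :: "nat \<Rightarrow> ('a ^ 'n) set" where
  "local_words i = {c. supp c \<subseteq> supp (h i) \<and> pairing (h i) c = 0}"

definition part :: "nat \<Rightarrow> 'a ^ 'n \<Rightarrow> 'a ^ 'n" where
  "part i c = (\<chi> x. if x \<in> supp (h i) then c $ x else 0)"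

text \<open>The supports are \<open>l\<close> disjoint sets of size \<open>3\<close> among
  \<open>3 * l\<close> coordinates, so they leave nothing out.\<close>

lemma covered: "\<exists>i\<in>{1..l}. x \<in> supp (h i)"
proof -
  have "card (\<Union>i\<in>{1..l}. supp (h i)) = (\<Sum>i\<in>{1..l}. card (supp (h i)))"
    by (rule card_UN_disjoint) (auto simp: disjoint)
  also have "\<dots> = (\<Sum>i\<in>{1..l}. 3)" by (rule sum.cong) (simp_all add: card_supp)
  also have "\<dots> = CARD('n)" by (simp add: length)
  finally have "(\<Union>i\<in>{1..l}. supp (h i)) = UNIV" by (simp add: card_eq_UNIV_imp_eq_UNIV)
  then show ?thesis by blast
qed

lemma group_unique: "i \<in> {1..l} \<Longrightarrow> j \<in> {1..l} \<Longrightarrow> x \<in> supp (h i) \<Longrightarrow> x \<in> supp (h j) \<Longrightarrow> i = j"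
  using disjoint by blast

lemma subspace_words: "vec.subspace words"
  by (auto simp: vec.subspace_def words_def pairing_add pairing_scale pairing_0)

lemma subspace_local_words: "vec.subspace (local_words i)"
proof -
  have "local_words i = {c. (\<forall>x. x \<notin> supp (h i) \<longrightarrow> c $ x = 0) \<and> pairing (h i) c = 0}"
    unfolding local_words_def by (auto simp: supp_def)
  then show ?thesis by (auto simp: vec.subspace_def pairing_add pairing_scale pairing_0)
qed

lemma local_words_subset: "i \<in> {1..l} \<Longrightarrow> local_words i \<subseteq> words"
proof (intro subsetI)
  fix c assume i: "i \<in> {1..l}" and c: "c \<in> local_words i"
  have "pairing (h j) c = 0" if j: "j \<in> {1..l}" for j
  proof (cases "j = i")
    case False
    then have "c $ x = 0" if "x \<in> supp (h j)" for x
      using disjoint[OF i j] c that unfolding local_words_def by (auto simp: supp_def)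
    then show ?thesis by (simp add: pairing_supp)
  qed (use c in \<open>simp add: local_words_def\<close>)
  then show "c \<in> words" by (simp add: words_def)
qed

lemma part_in_local_words: "c \<in> words \<Longrightarrow> i \<in> {1..l} \<Longrightarrow> part i c \<in> local_words i"
  unfolding local_words_def words_def
  by (auto simp: pairing_supp part_def supp_def split: if_splits)

lemma sum_parts: "(\<Sum>i\<in>{1..l}. part i c) = c"
proof (subst vec_eq_iff, intro allI)
  fix x
  obtain i where i: "i \<in> {1..l}" "x \<in> supp (h i)" using covered by blast
  have "(\<Sum>j\<in>{1..l}. part j c) $ x = (\<Sum>j\<in>{1..l}. if j = i then c $ x else 0)"
    unfolding sum_component
  proof (rule sum.cong[OF refl])
    fix j assume j: "j \<in> {1..l}"
    show "part j c $ x = (if j = i then c $ x else 0)"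
      using group_unique[OF j i(1) _ i(2)] i(2) unfolding part_def by (cases "j = i") auto
  qed
  then show "(\<Sum>j\<in>{1..l}. part j c) $ x = c $ x" using i by simp
qed

text \<open>The parts live on disjoint groups that cover all coordinates, so weights add up. This
  reduces weight questions to single groups.\<close>

lemma card_supp_parts: "card (supp c) = (\<Sum>i\<in>{1..l}. card (supp (part i c)))"
proof -
  have "supp c = (\<Union>i\<in>{1..l}. supp (part i c))"
    using covered by (fastforce simp: supp_def part_def split: if_splits)
  also have "card \<dots> = (\<Sum>i\<in>{1..l}. card (supp (part i c)))"
  proof (rule card_UN_disjoint)
    show "\<forall>i\<in>{1..l}. \<forall>j\<in>{1..l}. i \<noteq> j \<longrightarrow> supp (part i c) \<inter> supp (part j c) = {}"
    proof (intro ballI impI)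
      fix i j assume "i \<in> {1..l}" "j \<in> {1..l}" "i \<noteq> j"
      then have "supp (h i) \<inter> supp (h j) = {}" by (rule disjoint)
      moreover have "supp (part i c) \<subseteq> supp (h i)" "supp (part j c) \<subseteq> supp (h j)"
        by (auto simp: supp_def part_def)
      ultimately show "supp (part i c) \<inter> supp (part j c) = {}" by blast
    qed
  qed simp_all
  finally show ?thesis .
qed

text \<open>The checks are independent because each group has a coordinate of its own. The map
  \<open>T\<close> evaluates all checks and has rank \<open>l\<close>, so its kernel has dimension
  \<open>3 * l - l\<close>.\<close>

lemma dim_words: "vec.dim words = 2 * l"
proof -
  have "\<forall>i\<in>{1..l}. \<exists>x. x \<in> supp (h i)"
    using card_supp by (metis card.empty equals0I zero_neq_numeral)
  \<comment> \<open>\<open>e i\<close> is a representative coordinate of group \<open>i\<close>;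
    \<open>g\<close> below sends a coordinate to its group.\<close>
  from bchoice[OF this] obtain e where e: "\<forall>i\<in>{1..l}. e i \<in> supp (h i)" ..
  have "\<forall>x. \<exists>i. i \<in> {1..l} \<and> x \<in> supp (h i)" using covered by blast
  from choice[OF this] obtain g where g: "\<forall>x. g x \<in> {1..l} \<and> x \<in> supp (h (g x))" ..
  have ge: "g (e i) = i" if "i \<in> {1..l}" for i
    using group_unique[of "g (e i)" i "e i"] g e that by blast
  define E where "E = e ` {1..l}"
  have "inj_on e {1..l}" using ge by (metis inj_onI)
  then have cardE: "card E = l" unfolding E_def by (simp add: card_image)
  \<comment> \<open>The value of each check is stored at the representative of its group, so that
    \<open>T\<close> is an endomorphism whose image is a coordinate subspace of dimension
    \<open>card E\<close>.\<close>
  define T :: "'a ^ 'n \<Rightarrow> 'a ^ 'n" where "T c = (\<chi> x. if x \<in> E then pairing (h (g x)) c else 0)" for c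
  have lin: "Vector_Spaces.linear (*s) (*s) T"
    by unfold_locales (auto simp: T_def vec_eq_iff pairing_add pairing_scale)
  have "words = {c \<in> UNIV. T c = 0}"
    using ge g unfolding words_def T_def E_def by (auto simp: vec_eq_iff)
  moreover have "T ` UNIV = {v. \<forall>x. x \<notin> E \<longrightarrow> v $ x = 0}"
  proof (intro subset_antisym subsetI)
    fix v :: "'a ^ 'n" assume v: "v \<in> {v. \<forall>x. x \<notin> E \<longrightarrow> v $ x = 0}"
    \<comment> \<open>A preimage of \<open>v\<close> supported on \<open>E\<close>: each group meets
      \<open>E\<close> in one coordinate, so its check has a single term, and the division makes
      that term the required entry of \<open>v\<close>.\<close>
    define c :: "'a ^ 'n" where "c = (\<chi> x. if x \<in> E then v $ x / h (g x) $ x else 0)"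
    have "T c $ x = v $ x" for x
    proof (cases "x \<in> E")
      case True
      then obtain i where i: "i \<in> {1..l}" "x = e i" unfolding E_def by blast
      have x: "x \<in> supp (h i)" using e i by blast
      have "pairing (h i) c = (\<Sum>y\<in>supp (h i). if y = x then v $ x else 0)"
        unfolding pairing_supp
      proof (rule sum.cong[OF refl])
        fix y assume y: "y \<in> supp (h i)"
        show "h i $ y * c $ y = (if y = x then v $ x else 0)"
        proof (cases "y \<in> E")
          case True
          then obtain j where j: "j \<in> {1..l}" "y = e j" unfolding E_def by blast
          then have "i = j" using group_unique[of i j y] e i y by blast
          then show ?thesis using True j i x ge by (simp add: c_def supp_def)
        qed (use True in \<open>auto simp: c_def\<close>)
      qed
      also have "\<dots> = v $ x" using x by simp
      finally show ?thesis using True i ge by (simp add: T_def)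
    next
      case False then show ?thesis using v by (simp add: T_def)
    qed
    then have "v = T c" by (simp add: vec_eq_iff)
    then show "v \<in> T ` UNIV" by blast
  qed (auto simp: T_def)
  ultimately have "3 * l = vec.dim words + l"
    using vec_rank_nullity[OF lin vec.subspace_UNIV] dim_substandard_cart[of E] cardE
    by (simp add: card_cart_basis length)
  then show ?thesis by simp
qed

section \<open>Weights and dimension of the code on one group\<close>

text \<open>For a word of weight \<open>1\<close> inside the group, the check would consist of one
  non-zero term.\<close>

lemma local_words_card_supp:
  assumes "i \<in> {1..l}" "c \<in> local_words i" "c \<noteq> 0"
  shows "2 \<le> card (supp c)" "card (supp c) \<le> 3"
proof -
  have sub: "supp c \<subseteq> supp (h i)" using assms(2) by (simp add: local_words_def)
  then show "card (supp c) \<le> 3" using card_supp[OF assms(1)] by (metis card_mono finite)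
  show "2 \<le> card (supp c)"
  proof (rule ccontr)
    assume "\<not> 2 \<le> card (supp c)"
    moreover have "card (supp c) \<noteq> 0" using assms(3) by (simp add: supp_empty_iff)
    ultimately have "card (supp c) = 1" by linarith
    then obtain x where x: "supp c = {x}" by (auto simp: card_1_singleton_iff)
    have "pairing (h i) c = (\<Sum>y\<in>supp (h i). if y = x then h i $ x * c $ x else 0)"
      unfolding pairing_supp by (rule sum.cong) (use x in \<open>auto simp: supp_def\<close>)
    also have "\<dots> = h i $ x * c $ x" using sub x by simp
    also have "\<dots> \<noteq> 0" using sub x by (auto simp: supp_def)
    finally show False using assms(2) by (simp add: local_words_def)
  qed
qed

lemma local_words_vanishing:
  assumes "i \<in> {1..l}" "c \<in> local_words i" "x \<in> supp (h i)" "c $ x = 0"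
  shows "card (supp c) \<le> 2"
proof -
  have "supp c \<subseteq> supp (h i) - {x}" using assms(2,4) by (auto simp: local_words_def supp_def)
  moreover have "card (supp (h i) - {x}) = 2" using card_supp[OF assms(1)] assms(3) by simp
  ultimately show ?thesis by (metis card_mono finite)
qed

text \<open>Two zeros in a group of three leave weight at most \<open>1\<close>, which is below the
  least non-zero weight. Consequently the three vanishing conditions define distinct points.\<close>

lemma local_words_eq_0:
  assumes "i \<in> {1..l}" "c \<in> local_words i" "x \<in> supp (h i)" "y \<in> supp (h i)" "x \<noteq> y"
    and "c $ x = 0" "c $ y = 0"
  shows "c = 0"
proof (rule ccontr)
  assume "c \<noteq> 0"
  have "supp c \<subseteq> supp (h i) - {x, y}" using assms by (auto simp: local_words_def supp_def)
  moreover have "card (supp (h i) - {x, y}) = 1"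
    using card_supp[OF assms(1)] assms by (simp add: card_Diff_subset)
  ultimately have "card (supp c) \<le> 1" by (metis card_mono finite)
  then show False using local_words_card_supp(1)[OF assms(1,2) \<open>c \<noteq> 0\<close>] by simp
qed

text \<open>The check determines the entry at \<open>z\<close> from those at \<open>x\<close> and
  \<open>y\<close>, so \<open>local_words i\<close> is parametrized by two coordinates, and by one
  after \<open>c $ x = 0\<close> is imposed.\<close>

lemma local_words_coords:
  assumes i: "i \<in> {1..l}" and x: "x \<in> supp (h i)"
  obtains w w' where "w \<noteq> 0" "w' \<noteq> 0" "{c \<in> local_words i. c $ x = 0} = vec.span {w}"
    "local_words i = vec.span {w, w'}" "vec.independent {w, w'}" "w \<noteq> w'"
proof -
  obtain y z where yz: "supp (h i) = {x, y, z}" "x \<noteq> y" "x \<noteq> z" "y \<noteq> z"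
  proof -
    have "card (supp (h i) - {x}) = 2" using card_supp[OF i] x by simp
    then obtain y z where "supp (h i) - {x} = {y, z}" "y \<noteq> z" by (auto simp: card_2_iff)
    then show ?thesis using that x by blast
  qed
  have nz: "h i $ x \<noteq> 0" "h i $ y \<noteq> 0" "h i $ z \<noteq> 0" using yz(1) by (auto simp: supp_def)
  \<comment> \<open>On \<open>(x, y, z)\<close> the two words are \<open>(0, h_z, - h_y)\<close> and
    \<open>(h_z, 0, - h_x)\<close>, where \<open>h_x\<close> stands for \<open>h i $ x\<close> and
    so on: the two terms of the check cancel.\<close>
  define w :: "'a ^ 'n" where "w = (\<chi> t. if t = y then h i $ z else if t = z then - h i $ y else 0)"
  define w' :: "'a ^ 'n" where "w' = (\<chi> t. if t = x then h i $ z else if t = z then - h i $ x else 0)"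
  have pr: "pairing (h i) c = h i $ x * c $ x + h i $ y * c $ y + h i $ z * c $ z" for c
    unfolding pairing_supp yz(1) using yz by (simp add: add.assoc)
  have ww: "w \<in> local_words i" "w' \<in> local_words i" "w $ x = 0"
    using yz nz by (auto simp: local_words_def pr w_def w'_def supp_def split: if_splits)
  \<comment> \<open>The coefficients are read off at \<open>y\<close>, where \<open>w'\<close>
    vanishes, and at \<open>x\<close>, where \<open>w\<close> vanishes; the check settles the entry
    at \<open>z\<close>.\<close>
  have eq: "c = (c $ y / h i $ z) *s w + (c $ x / h i $ z) *s w'" if c: "c \<in> local_words i" for c
  proof -
    have "c $ t = ((c $ y / h i $ z) *s w + (c $ x / h i $ z) *s w') $ t" for t
    proof (cases "t \<in> {x, y, z}")
      case True
      have "h i $ z * c $ z = - (h i $ x * c $ x) - h i $ y * c $ y"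
        using c by (simp add: local_words_def pr eq_neg_iff_add_eq_0 algebra_simps)
      then have "c $ z = (- (h i $ x * c $ x) - h i $ y * c $ y) / h i $ z"
        using nz(3) by (metis nonzero_mult_div_cancel_left)
      then have "c $ z = - (c $ y / h i $ z * h i $ y) - c $ x / h i $ z * h i $ x"
        by (simp add: diff_divide_distrib mult.commute)
      moreover have "c $ y = c $ y / h i $ z * h i $ z" "c $ x = c $ x / h i $ z * h i $ z"
        using nz(3) by simp_all
      ultimately show ?thesis using True yz(2-4) by (auto simp: w_def w'_def)
    next
      case False
      then have "c $ t = 0" using c yz by (auto simp: local_words_def supp_def)
      then show ?thesis using False by (simp add: w_def w'_def)
    qed
    then show ?thesis by (intro iffD2[OF vec_eq_iff] allI)
  qed
  have "w $ y \<noteq> 0" "w' $ x \<noteq> 0" using yz nz by (auto simp: w_def w'_def)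
  then have "w \<noteq> 0" "w' \<noteq> 0" "w \<noteq> w'" using ww(3) by auto
  have W1: "{c \<in> local_words i. c $ x = 0} = vec.span {w}"
  proof (intro subset_antisym subsetI)
    fix c assume "c \<in> {c \<in> local_words i. c $ x = 0}"
    then have c: "c = (c $ y / h i $ z) *s w" using eq[of c] by simp
    show "c \<in> vec.span {w}" by (rule ssubst[OF c]) (simp add: vec.span_base vec.span_scale)
  next
    fix c assume "c \<in> vec.span {w}"
    then obtain k where "c = k *s w" by (auto simp: vec.span_singleton)
    then show "c \<in> {c \<in> local_words i. c $ x = 0}"
      using ww vec.subspace_scale[OF subspace_local_words] by simp
  qed
  have W2: "local_words i = vec.span {w, w'}"
  proof (intro subset_antisym subsetI)
    fix c assume "c \<in> local_words i"
    then have "c = (c $ y / h i $ z) *s w + (c $ x / h i $ z) *s w'" by (rule eq)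
    then show "c \<in> vec.span {w, w'}"
      by (rule ssubst) (simp add: vec.span_add vec.span_base vec.span_scale)
  next
    fix c assume "c \<in> vec.span {w, w'}"
    then show "c \<in> local_words i"
      using vec.span_minimal[OF _ subspace_local_words, of "{w, w'}" i] ww by auto
  qed
  have "w' \<notin> vec.span {w}" unfolding W1[symmetric] using \<open>w' $ x \<noteq> 0\<close> by simp
  then have "vec.independent {w', w}"
    by (rule vec.independent_insertI) (simp add: \<open>w \<noteq> 0\<close>)
  then have "vec.independent {w, w'}" by (simp add: insert_commute)
  then show ?thesis using that W1 W2 \<open>w \<noteq> 0\<close> \<open>w' \<noteq> 0\<close> \<open>w \<noteq> w'\<close> by blast
qed

lemma dim_local_words:
  assumes "i \<in> {1..l}"
  shows "vec.dim (local_words i) = 2"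
proof -
  obtain x where "x \<in> supp (h i)" using card_supp[OF assms] by fastforce
  then obtain w w' where "local_words i = vec.span {w, w'}" "vec.independent {w, w'}" "w \<noteq> w'"
    using local_words_coords[OF assms] by metis
  then show ?thesis by (simp add: vec.dim_span_eq_card_independent del: vec.dim_span)
qed

lemma dim_local_words_vanishing:
  assumes "i \<in> {1..l}" "x \<in> supp (h i)"
  shows "vec.subspace {c \<in> local_words i. c $ x = 0}" "vec.dim {c \<in> local_words i. c $ x = 0} = 1"
proof -
  obtain w where "{c \<in> local_words i. c $ x = 0} = vec.span {w}" "w \<noteq> 0"
    using local_words_coords[OF assms] by metis
  then show "vec.subspace {c \<in> local_words i. c $ x = 0}"
    "vec.dim {c \<in> local_words i. c $ x = 0} = 1" by simp_all
qed

lemma part_add: "part i (c + d) = part i c + part i d"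
  by (simp add: part_def vec_eq_iff)

lemma part_0: "part i 0 = 0"
  by (simp add: part_def vec_eq_iff)

lemma part_local_words:
  assumes "i \<in> {1..l}" "j \<in> {1..l}" "c \<in> local_words j"
  shows "part i c = (if i = j then c else 0)"
proof -
  have "c $ x = 0" if "x \<notin> supp (h j)" for x
    using assms(3) that unfolding local_words_def by (auto simp: supp_def)
  then show ?thesis using disjoint[OF assms(1,2)] by (auto simp: part_def vec_eq_iff)
qed

section \<open>Translation between word weights and configurations\<close>

text \<open>Every violated condition yields a non-zero word of weight at most \<open>6\<close> in
  the kernel: one local word of weight at most \<open>3\<close>, a difference of two such words, or
  a sum of three local words of weight at most \<open>2\<close>.\<close>

lemma line_config_of_map:
  fixes \<phi> :: "'a ^ 'n \<Rightarrow> 'a ^ 'm::finite"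
  assumes lin: "Vector_Spaces.linear (*s) (*s) \<phi>"
    and weight: "\<And>c. c \<in> words \<Longrightarrow> \<phi> c = 0 \<Longrightarrow> c \<noteq> 0 \<Longrightarrow> 7 \<le> card (supp c)"
    and pos: "\<And>i. i \<in> {1..l} \<Longrightarrow> bij_betw (pos i) {1..3::nat} (supp (h i))"
  shows "line_config (\<lambda>i. \<phi> ` local_words i) (\<lambda>i \<mu>. \<phi> ` {c \<in> local_words i. c $ pos i \<mu> = 0}) l"
proof -
  interpret f: Vector_Spaces.linear "(*s)" "(*s)" \<phi> by (rule lin)
  have pos_mem: "pos i \<mu> \<in> supp (h i)" if "i \<in> {1..l}" "\<mu> \<in> {1..3}" for i \<mu>
    using pos[OF that(1)] that(2) unfolding bij_betw_def by blast
  have ker: "c = 0" if i: "i \<in> {1..l}" and c: "c \<in> local_words i" "\<phi> c = 0" for i c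
  proof (rule ccontr)
    assume "c \<noteq> 0"
    moreover have "c \<in> words" using local_words_subset[OF i] c(1) by blast
    ultimately have "7 \<le> card (supp c)" using weight c(2) by blast
    then show False using local_words_card_supp(2)[OF i c(1) \<open>c \<noteq> 0\<close>] by simp
  qed
  have card0: "card (supp c) \<le> 3" if "i \<in> {1..l}" "c \<in> local_words i" for i c
    using local_words_card_supp(2)[OF that] by (cases "c = 0") (simp_all add: supp_0)
  have dim: "vec.dim (\<phi> ` S) = vec.dim S"
    if "i \<in> {1..l}" "S \<subseteq> local_words i" "vec.subspace S" for i S
    using vec_dim_image_trivial_kernel[OF lin that(3)] ker[OF that(1)] that(2) by blast
  show ?thesis
  proof (rule line_configI)
    fix i assume i: "i \<in> {1..l}"
    show "vec.subspace (\<phi> ` local_words i)" by (rule f.subspace_image[OF subspace_local_words])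
    show "vec.dim (\<phi> ` local_words i) = 2"
      using dim[OF i order.refl subspace_local_words] dim_local_words[OF i] by simp
    \<comment> \<open>By injectivity of \<open>\<phi>\<close> on local words, equal points would
      make a non-zero word vanish at two coordinates of one group.\<close>
    show "inj_on (\<lambda>\<mu>. \<phi> ` {c \<in> local_words i. c $ pos i \<mu> = 0}) {1..3}"
    proof (rule inj_onI, rule ccontr)
      fix \<mu> \<nu> :: nat
      assume \<mu>\<nu>: "\<mu> \<in> {1..3}" "\<nu> \<in> {1..3}" "\<mu> \<noteq> \<nu>"
        and eq: "\<phi> ` {c \<in> local_words i. c $ pos i \<mu> = 0} = \<phi> ` {c \<in> local_words i. c $ pos i \<nu> = 0}"
      have neq: "pos i \<mu> \<noteq> pos i \<nu>"
        using pos[OF i] \<mu>\<nu> unfolding bij_betw_def inj_on_def by blast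
      obtain w where w: "w \<noteq> 0" "{c \<in> local_words i. c $ pos i \<mu> = 0} = vec.span {w}"
        using local_words_coords[OF i pos_mem[OF i \<mu>\<nu>(1)]] by metis
      then have w': "w \<in> local_words i" "w $ pos i \<mu> = 0" using vec.span_base[of w "{w}"] by auto
      then have "\<phi> w \<in> \<phi> ` {c \<in> local_words i. c $ pos i \<nu> = 0}" using eq by blast
      then obtain v where v: "\<phi> w = \<phi> v" "v \<in> local_words i" "v $ pos i \<nu> = 0" by blast
      have "w - v \<in> local_words i" using w'(1) v(2) subspace_local_words vec.subspace_diff by blast
      moreover have "\<phi> (w - v) = 0" using v(1) f.diff[of w v] by simp
      ultimately have "w - v = 0" using ker[OF i] by blast
      then have "w $ pos i \<nu> = 0" using v(3) by simp
      then show False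
        using local_words_eq_0[OF i w'(1) pos_mem[OF i \<mu>\<nu>(1)] pos_mem[OF i \<mu>\<nu>(2)] neq w'(2)] w(1)
        by simp
    qed
  next
    fix i \<mu> :: nat assume i: "i \<in> {1..l}" and \<mu>: "\<mu> \<in> {1..3}"
    note S = dim_local_words_vanishing[OF i pos_mem[OF i \<mu>]]
    show "\<phi> ` {c \<in> local_words i. c $ pos i \<mu> = 0} \<in> pg_points"
      using dim[OF i _ S(1)] S(2) f.subspace_image[OF S(1)] unfolding pg_points_def by simp
    show "\<phi> ` {c \<in> local_words i. c $ pos i \<mu> = 0} \<subseteq> \<phi> ` local_words i" by blast
  next
    fix i j assume ij: "i \<in> {1..l}" "j \<in> {1..l}" "i \<noteq> j"
    have "\<phi> c = 0" if c: "c \<in> local_words i" and d: "d \<in> local_words j" and eq: "\<phi> c = \<phi> d" for c d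
    proof -
      have "c - d \<in> words"
        using local_words_subset ij c d vec.subspace_diff[OF subspace_words] by blast
      moreover have "\<phi> (c - d) = 0" using eq f.diff[of c d] by simp
      moreover have "card (supp (c - d)) \<le> 6"
        using card_supp_diff[of c d] card0[OF ij(1) c] card0[OF ij(2) d] by linarith
      ultimately have "c - d = 0" using weight[of "c - d"] by linarith
      then have "part i c = part i d" by simp
      then have "c = 0" using part_local_words[OF ij(1,1) c] part_local_words[OF ij(1,2) d] ij(3) by simp
      then show ?thesis by simp
    qed
    moreover have "0 \<in> \<phi> ` local_words k" for k
      using f.subspace_image[OF subspace_local_words] vec.subspace_0 by blast
    ultimately show "\<phi> ` local_words i \<inter> \<phi> ` local_words j = {0}" by blast
  next
    fix i j m \<mu> \<nu> \<omega> :: nat and x y z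
    assume i: "i \<in> {1..l}" and j: "j \<in> {1..l}" and m: "m \<in> {1..l}"
      and neq: "i \<noteq> j" "i \<noteq> m" "j \<noteq> m"
      and \<mu>: "\<mu> \<in> {1..3}" and \<nu>: "\<nu> \<in> {1..3}" and \<omega>: "\<omega> \<in> {1..3}"
      and x: "x \<in> \<phi> ` {c \<in> local_words i. c $ pos i \<mu> = 0} - {0}"
      and y: "y \<in> \<phi> ` {c \<in> local_words j. c $ pos j \<nu> = 0} - {0}"
      and z: "z \<in> \<phi> ` {c \<in> local_words m. c $ pos m \<omega> = 0} - {0}"
    obtain a where a: "a \<in> local_words i" "a $ pos i \<mu> = 0" "x = \<phi> a" "x \<noteq> 0" using x by blast
    obtain b where b: "b \<in> local_words j" "b $ pos j \<nu> = 0" "y = \<phi> b" using y by blast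
    obtain c where c: "c \<in> local_words m" "c $ pos m \<omega> = 0" "z = \<phi> c" using z by blast
    show "x + y + z \<noteq> 0"
    proof
      assume "x + y + z = 0"
      then have "\<phi> (a + b + c) = 0" using a b c f.add by simp
      moreover have "a + b + c \<in> words"
        using a(1) b(1) c(1) local_words_subset i j m
        by (intro vec.subspace_add[OF subspace_words]) blast+
      moreover have "card (supp (a + b + c)) \<le> 6"
        using card_supp_add[of "a + b" c] card_supp_add[of a b]
          local_words_vanishing[OF i a(1) pos_mem[OF i \<mu>] a(2)]
          local_words_vanishing[OF j b(1) pos_mem[OF j \<nu>] b(2)]
          local_words_vanishing[OF m c(1) pos_mem[OF m \<omega>] c(2)] by linarith
      ultimately have "a + b + c = 0" using weight[of "a + b + c"] by linarith
      \<comment> \<open>Restriction to group \<open>i\<close> kills \<open>b\<close> and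
        \<open>c\<close> and isolates \<open>a\<close>, whose image was assumed non-zero.\<close>
      then have "part i a + part i b + part i c = 0" by (metis part_add part_0)
      then have "a = 0"
        using part_local_words[OF i i a(1)] part_local_words[OF i j b(1)]
          part_local_words[OF i m c(1)] neq by simp
      then show False using a by simp
    qed
  qed
qed

text \<open>Each non-zero part weighs at least \<open>2\<close>, so a word of weight at most
  \<open>6\<close> meets at most three groups. Injectivity on local words, skewness and general
  position rule out one, two and three groups respectively.\<close>

lemma weight_of_line_config:
  fixes \<phi> :: "'a ^ 'n \<Rightarrow> 'a ^ 'm::finite"
  assumes lin: "Vector_Spaces.linear (*s) (*s) \<phi>" and config: "line_config U P l"
    and pos: "\<And>i. i \<in> {1..l} \<Longrightarrow> bij_betw (pos i) {1..3::nat} (supp (h i))"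
    and ker: "\<And>i c. i \<in> {1..l} \<Longrightarrow> c \<in> local_words i \<Longrightarrow> \<phi> c = 0 \<Longrightarrow> c = 0"
    and line: "\<And>i c. i \<in> {1..l} \<Longrightarrow> c \<in> local_words i \<Longrightarrow> \<phi> c \<in> U i"
    and point: "\<And>i c \<mu>. i \<in> {1..l} \<Longrightarrow> c \<in> local_words i \<Longrightarrow> \<mu> \<in> {1..3} \<Longrightarrow>
      c $ pos i \<mu> = 0 \<Longrightarrow> \<phi> c \<in> P i \<mu>"
    and c: "c \<in> words" "\<phi> c = 0" "c \<noteq> 0"
  shows "7 \<le> card (supp c)"
proof (rule ccontr)
  assume "\<not> 7 \<le> card (supp c)"
  then have le6: "card (supp c) \<le> 6" by simp
  interpret f: Vector_Spaces.linear "(*s)" "(*s)" \<phi> by (rule lin)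
  define I where "I = {i \<in> {1..l}. part i c \<noteq> 0}"
  have I: "i \<in> {1..l}" "part i c \<in> local_words i" "part i c \<noteq> 0" "2 \<le> card (supp (part i c))"
    "\<phi> (part i c) \<in> U i" "\<phi> (part i c) \<noteq> 0" if "i \<in> I" for i
    using that part_in_local_words[OF c(1)] local_words_card_supp(1) line ker unfolding I_def by blast+
  have finI: "finite I" "I \<subseteq> {1..l}" by (auto simp: I_def)
  have card_c: "card (supp c) = (\<Sum>i\<in>I. card (supp (part i c)))"
    unfolding card_supp_parts[of c]
    by (rule sum.mono_neutral_right) (auto simp: I_def supp_0)
  have "(\<Sum>i\<in>{1..l}. part i c) = (\<Sum>i\<in>I. part i c)"
    by (rule sum.mono_neutral_right) (auto simp: I_def)
  then have c_sum: "c = (\<Sum>i\<in>I. part i c)" by (simp only: sum_parts)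
  have "\<phi> (\<Sum>i\<in>I. part i c) = 0" using c(2) c_sum by simp
  then have sum0: "(\<Sum>i\<in>I. \<phi> (part i c)) = 0" by (simp only: f.sum)
  have "(\<Sum>i\<in>I. 2) \<le> (\<Sum>i\<in>I. card (supp (part i c)))" by (rule sum_mono) (rule I)
  then have "card I \<le> 3" using card_c le6 by simp
  then consider "card I = 0" | "card I = 1" | "card I = 2" | "card I = 3" by linarith
  then show False
  proof cases
    case 1
    then have "I = {}" using finI by simp
    then show False using c_sum c(3) by simp
  next
    case 2
    then obtain i where "I = {i}" by (auto simp: card_1_singleton_iff)
    then show False using sum0 I(6) by simp
  next
    case 3
    then obtain i j where ij: "I = {i, j}" "i \<noteq> j" by (auto simp: card_2_iff)
    then have mem: "i \<in> I" "j \<in> I" by auto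
    have "\<phi> (part i c) + \<phi> (part j c) = 0" using sum0 ij by simp
    then have "\<phi> (part i c) = 0"
      using trivial_Int_sum_eq_0[OF line_configD(1)[OF config I(1)[OF mem(1)]]
          line_configD(1)[OF config I(1)[OF mem(2)]]
          line_configD(6)[OF config I(1)[OF mem(1)] I(1)[OF mem(2)] ij(2)]
          I(5)[OF mem(1)] I(5)[OF mem(2)]] by simp
    then show False using I(6) mem by blast
  next
    case 4
    then obtain i j m where ijm: "I = {i, j, m}" "i \<noteq> j" "i \<noteq> m" "j \<noteq> m"
      by (auto simp: card_3_iff)
    then have mem: "i \<in> I" "j \<in> I" "m \<in> I" by auto
    have "card (supp (part i c)) + card (supp (part j c)) + card (supp (part m c)) \<le> 6"
      using card_c le6 ijm by simp
    \<comment> \<open>Three parts of weight at least \<open>2\<close> with total at most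
      \<open>6\<close> all have weight exactly \<open>2\<close>; the upper bound is what
      matters.\<close>
    then have le2: "card (supp (part k c)) \<le> 2" if "k \<in> I" for k
      using I(4)[OF mem(1)] I(4)[OF mem(2)] I(4)[OF mem(3)] that unfolding ijm(1) by auto
    have "\<exists>\<mu>\<in>{1..3}. \<phi> (part k c) \<in> P k \<mu> - {0}" if k: "k \<in> I" for k
    proof -
      note k' = I(1)[OF k]
      \<comment> \<open>A part of weight at most \<open>2\<close> misses a coordinate of its group,
        which places its image in one of the three chosen points.\<close>
      have "\<not> supp (h k) \<subseteq> supp (part k c)"
      proof
        assume "supp (h k) \<subseteq> supp (part k c)"
        then have "card (supp (h k)) \<le> card (supp (part k c))" by (rule card_mono[rotated]) simp
        then show False using card_supp[OF k'] le2[OF k] by simp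
      qed
      then obtain x where x: "x \<in> supp (h k)" "part k c $ x = 0" by (auto simp: supp_def)
      then obtain \<mu> where \<mu>: "\<mu> \<in> {1..3}" "x = pos k \<mu>"
        using pos[OF k'] unfolding bij_betw_def by blast
      then show ?thesis using point[OF k' I(2)[OF k] \<mu>(1)] x(2) I(6)[OF k] by blast
    qed
    then obtain \<mu> \<nu> \<omega> where "\<mu> \<in> {1..3}" "\<phi> (part i c) \<in> P i \<mu> - {0}"
      "\<nu> \<in> {1..3}" "\<phi> (part j c) \<in> P j \<nu> - {0}"
      "\<omega> \<in> {1..3}" "\<phi> (part m c) \<in> P m \<omega> - {0}" using mem by metis
    then have "\<phi> (part i c) + \<phi> (part j c) + \<phi> (part m c) \<noteq> 0"
      using line_config_indep[OF config I(1)[OF mem(1)] I(1)[OF mem(2)] I(1)[OF mem(3)] ijm(2-4)]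
      by blast
    then show False using sum0 ijm by (simp add: add.assoc)
  qed
qed

end

section \<open>Codes and configurations\<close>

lemma hamming_dist_supp:
  fixes x y :: "'a::group_add ^ 'n::finite"
  shows "hamming_dist x y = card (supp (x - y))"
  by (simp add: hamming_dist_def supp_def)

lemma min_dist_le_card_supp:
  fixes C :: "('a::{field,finite} ^ 'n::finite) set"
  assumes "vec.subspace C" "c \<in> C" "c \<noteq> 0"
  shows "min_dist C \<le> card (supp c)"
proof -
  have "0 \<in> C" using assms(1) by (rule vec.subspace_0)
  then have "hamming_dist c 0 \<in> {hamming_dist x y | x y. x \<in> C \<and> y \<in> C \<and> x \<noteq> y}"
    using assms(2,3) by blast
  moreover have "finite {hamming_dist x y | x y. x \<in> C \<and> y \<in> C \<and> x \<noteq> y}"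
    by (rule finite_subset[of _ "case_prod hamming_dist ` UNIV"]) auto
  ultimately show ?thesis unfolding min_dist_def using Min_le hamming_dist_supp[of c 0] by simp
qed

text \<open>In a linear code, distances between distinct codewords are weights of non-zero
  codewords, so one light word and a lower bound on weights suffice.\<close>

lemma min_dist_eqI:
  fixes C :: "('a::{field,finite} ^ 'n::finite) set"
  assumes "vec.subspace C" "c \<in> C" "c \<noteq> 0" "card (supp c) \<le> d"
    and weight: "\<And>c. c \<in> C \<Longrightarrow> c \<noteq> 0 \<Longrightarrow> d \<le> card (supp c)"
  shows "min_dist C = d"
proof (rule antisym)
  show "min_dist C \<le> d" using min_dist_le_card_supp[OF assms(1-3)] assms(4) by linarith
  let ?D = "{hamming_dist x y | x y. x \<in> C \<and> y \<in> C \<and> x \<noteq> y}"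
  have "finite ?D" by (rule finite_subset[of _ "case_prod hamming_dist ` UNIV"]) auto
  moreover have "?D \<noteq> {}" using assms(2,3) vec.subspace_0[OF assms(1)] by blast
  moreover have "d \<le> t" if t: "t \<in> ?D" for t
  proof -
    obtain x y where xy: "t = hamming_dist x y" "x \<in> C" "y \<in> C" "x \<noteq> y" using t by blast
    then have "x - y \<in> C" "x - y \<noteq> 0" using vec.subspace_diff[OF assms(1)] by auto
    then show ?thesis using weight xy(1) hamming_dist_supp by metis
  qed
  ultimately show "d \<le> min_dist C" unfolding min_dist_def by simp
qed

text \<open>Three points on a line satisfy a linear relation, and distinctness makes all its terms
  non-zero. Taking these terms as generators normalizes the relation to a zero sum, which matches a
  repair check with all coefficients \<open>1\<close>.\<close>

lemma scaled_generators:
  fixes P :: "nat \<Rightarrow> ('a::field ^ 'm::finite) set"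
  assumes U: "vec.subspace U" "vec.dim U = 2" and inj: "inj_on P {1..3}"
    and P: "\<And>\<mu>. \<mu> \<in> {1..3} \<Longrightarrow> P \<mu> \<in> pg_points" "\<And>\<mu>. \<mu> \<in> {1..3} \<Longrightarrow> P \<mu> \<subseteq> U"
  obtains p where "\<And>\<mu>. \<mu> \<in> {1..3} \<Longrightarrow> p \<mu> \<in> P \<mu>" "\<And>\<mu>. \<mu> \<in> {1..3} \<Longrightarrow> p \<mu> \<noteq> 0"
    "p 1 + p 2 + p 3 = 0"
proof -
  have P': "vec.subspace (P \<mu>)" "vec.dim (P \<mu>) = 1" if "\<mu> \<in> {1..3}" for \<mu>
    using P(1)[OF that] by (auto simp: pg_points_def)
  have m: "1 \<in> {1..3::nat}" "2 \<in> {1..3::nat}" "3 \<in> {1..3::nat}" by auto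
  have neq: "P 1 \<noteq> P 2" "P 1 \<noteq> P 3" "P 2 \<noteq> P 3" 
    using inj_on_eq_iff[OF inj m(1,2)] inj_on_eq_iff[OF inj m(1,3)] inj_on_eq_iff[OF inj m(2,3)]
    by simp_all
  have "pg_collinear (P 1) (P 2) (P 3)"
    by (rule pg_collinear_in_plane[OF U P(1)[OF m(1)] P(1)[OF m(2)] P(1)[OF m(3)]
          P(2)[OF m(1)] P(2)[OF m(2)] P(2)[OF m(3)]])
  then obtain a b c where abc: "a \<in> P 1" "b \<in> P 2" "c \<in> P 3" "a + b + c = 0"
    "\<not> (a = 0 \<and> b = 0 \<and> c = 0)" by (rule pg_collinear_relation)
  have disj: "P \<mu> \<inter> P \<nu> = {0}" if "\<mu> \<in> {1..3}" "\<nu> \<in> {1..3}" "P \<mu> \<noteq> P \<nu>" for \<mu> \<nu>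
  proof -
    note \<mu>\<nu> = that
    have "x = 0" if x: "x \<in> P \<mu>" "x \<in> P \<nu>" for x
      using dim_1_span[OF P'[OF \<mu>\<nu>(1)] x(1)] dim_1_span[OF P'[OF \<mu>\<nu>(2)] x(2)] \<mu>\<nu>(3) by metis
    then show ?thesis using vec.subspace_0[OF P'(1)[OF that(1)]] vec.subspace_0[OF P'(1)[OF that(2)]]
      by blast
  qed
  have "a \<noteq> 0"
    using trivial_Int_sum_eq_0[OF P'(1)[OF m(2)] P'(1)[OF m(3)] disj[OF m(2,3) neq(3)] abc(2,3)] abc(4,5)
    by auto
  moreover have "b \<noteq> 0"
    using trivial_Int_sum_eq_0[OF P'(1)[OF m(1)] P'(1)[OF m(3)] disj[OF m(1,3) neq(2)] abc(1,3)] abc(4,5)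
    by auto
  moreover have "c \<noteq> 0"
    using trivial_Int_sum_eq_0[OF P'(1)[OF m(1)] P'(1)[OF m(2)] disj[OF m(1,2) neq(1)] abc(1,2)] abc(4,5)
    by auto
  moreover define p where "p \<mu> = (if \<mu> = 1 then a else if \<mu> = 2 then b else c)" for \<mu> :: nat
  moreover have "\<mu> = 1 \<or> \<mu> = 2 \<or> \<mu> = 3" if "\<mu> \<in> {1..3}" for \<mu> :: nat using that by auto
  ultimately show ?thesis using that[of p] abc by force
qed

section \<open>The two directions of the equivalence\<close>

text \<open>Optimality says exactly that \<open>C\<close> has codimension \<open>4\<close> in
  \<open>words\<close>, so \<open>C\<close> is the kernel there of a map to
  \<open>F\<^sup>4\<close>; minimum distance \<open>7\<close> then provides the weight bound for
  \<open>line_config_of_map\<close>.\<close>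

lemma line_config_of_code:
  fixes C :: "('a::{field,finite} ^ 'n::finite) set"
  assumes n: "CARD('n) = 3 * l" and opt: "singleton_optimal_lrc C k 7 2"
    and groups: "disjoint_repair_groups C 2"
  shows "\<exists>(U :: nat \<Rightarrow> ('a ^ 4) set) P. line_config U P l"
proof -
  have C: "vec.subspace C" "vec.dim C = k" "min_dist C = 7"
    and dim: "int CARD('n) - int k = int CARD('n) div (int 2 + 1) + int 7 - 2 - (int 7 - 2) div (int 2 + 1)"
    using opt unfolding singleton_optimal_lrc_def linear_code_def by auto
  \<comment> \<open>With \<open>n = 3 * l\<close> the optimality equation reads
    \<open>3 * l - k = l + 7 - 2 - 1\<close>, the last term being the floor of
    \<open>5 / 3\<close>.\<close>
  have k: "2 * l = k + 4" using dim n by simp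
  have "\<exists>h :: nat \<Rightarrow> 'a ^ 'n. (\<forall>i\<in>{1..l}. h i \<in> dual_code C \<and> hamming_weight (h i) = 3) \<and>
      (\<forall>i\<in>{1..l}. \<forall>j\<in>{1..l}. i \<noteq> j \<longrightarrow> supp (h i) \<inter> supp (h j) = {})"
    using groups n unfolding disjoint_repair_groups_def by simp
  then obtain h :: "nat \<Rightarrow> 'a ^ 'n"
    where h: "\<forall>i\<in>{1..l}. h i \<in> dual_code C \<and> hamming_weight (h i) = 3"
      and disj: "\<forall>i\<in>{1..l}. \<forall>j\<in>{1..l}. i \<noteq> j \<longrightarrow> supp (h i) \<inter> supp (h j) = {}" by (elim exE conjE)
  interpret repair_groups h l
    by unfold_locales (use h disj n in \<open>auto simp: hamming_weight_def\<close>)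
  have "C \<subseteq> words" using h unfolding words_def by (auto simp: mem_dual_code)
  moreover have "vec.dim words = vec.dim C + CARD(4)" using dim_words k C(2) by simp
  ultimately obtain \<phi> :: "'a ^ 'n \<Rightarrow> 'a ^ 4" where lin: "Vector_Spaces.linear (*s) (*s) \<phi>"
    and \<phi>: "\<And>x. x \<in> words \<Longrightarrow> \<phi> x = 0 \<longleftrightarrow> x \<in> C"
    using linear_map_with_kernel[OF subspace_words C(1)] by blast
  have "\<forall>i\<in>{1..l}. \<exists>g. bij_betw g {1..3::nat} (supp (h i))"
    by (auto intro!: finite_same_card_bij simp: card_supp)
  from bchoice[OF this] obtain pos where pos: "\<forall>i\<in>{1..l}. bij_betw (pos i) {1..3::nat} (supp (h i))" ..
  have "7 \<le> card (supp c)" if "c \<in> words" "\<phi> c = 0" "c \<noteq> 0" for c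
    using min_dist_le_card_supp[OF C(1) _ that(3)] \<phi>[OF that(1)] that(2) C(3) by simp
  from line_config_of_map[OF lin this bspec[OF pos]] show ?thesis by blast
qed

text \<open>The code is the kernel on \<open>words\<close> of a map sending the local words of group
  \<open>i\<close> onto \<open>U i\<close>. General position bounds the weights below by
  \<open>7\<close>, and the relation secured at the start of the proof gives a codeword of weight at
  most \<open>7\<close>.\<close>

lemma code_of_line_config:
  fixes U :: "nat \<Rightarrow> ('a::{field,finite} ^ 4) set"
  assumes n: "CARD('n::finite) = 3 * l" and l: "3 \<le> l" and config0: "line_config U P0 l"
  shows "\<exists>(C :: ('a ^ 'n) set) k. singleton_optimal_lrc C k 7 2 \<and> disjoint_repair_groups C 2"
proof -
  obtain P s t m \<mu>0 \<nu>0 a b r where config: "line_config U P l"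
    and stm: "s \<in> {1..l}" "t \<in> {1..l}" "m \<in> {1..l}" "s \<noteq> t" "s \<noteq> m" "t \<noteq> m"
    and \<mu>\<nu>: "\<mu>0 \<in> {1..3}" "\<nu>0 \<in> {1..3}"
    and abr: "a \<in> P s \<mu>0 - {0}" "b \<in> P t \<nu>0 - {0}" "r \<in> U m" "a + b + r = 0"
    by (rule line_config_with_relation[OF config0 l])
  note cfg = line_configD[OF config]
  have P: "vec.subspace (P i \<mu>)" "vec.dim (P i \<mu>) = 1" if "i \<in> {1..l}" "\<mu> \<in> {1..3}" for i \<mu>
    using cfg(4)[OF that] by (auto simp: pg_points_def)
  have "\<forall>i\<in>{1..l}. \<exists>p. (\<forall>\<mu>\<in>{1..3}. p \<mu> \<in> P i \<mu> \<and> p \<mu> \<noteq> 0) \<and> p 1 + p 2 + p (3::nat) = 0"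
  proof
    fix i assume i: "i \<in> {1..l}"
    show "\<exists>p. (\<forall>\<mu>\<in>{1..3}. p \<mu> \<in> P i \<mu> \<and> p \<mu> \<noteq> 0) \<and> p 1 + p 2 + p (3::nat) = 0"
      by (rule scaled_generators[OF cfg(1-3)[OF i] cfg(4,5)[OF i]]) blast+
  qed
  from bchoice[OF this] obtain p
    where p: "\<forall>i\<in>{1..l}. (\<forall>\<mu>\<in>{1..3}. p i \<mu> \<in> P i \<mu> \<and> p i \<mu> \<noteq> 0) \<and> p i 1 + p i 2 + p i (3::nat) = 0" ..
  have m3: "1 \<in> {1..3::nat}" "2 \<in> {1..3::nat}" "3 \<in> {1..3::nat}" by auto
  have three: "\<mu> = 1 \<or> \<mu> = 2 \<or> \<mu> = 3" if "\<mu> \<in> {1..3}" for \<mu> :: nat using that by auto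
  have p_mem: "p i \<mu> \<in> P i \<mu>" "p i \<mu> \<noteq> 0" if "i \<in> {1..l}" "\<mu> \<in> {1..3}" for i \<mu>
    using bspec[OF p that(1)] that(2) by blast+
  have p_sum: "p i 2 + p i 3 = - p i 1" if "i \<in> {1..l}" for i
    using bspec[OF p that] by (metis add.assoc add.inverse_unique)

  have "card (UNIV :: 'n set) = card ({1..l} \<times> {1..3::nat})" using n by simp
  then obtain X where X: "bij_betw X ({1..l} \<times> {1..3::nat}) (UNIV :: 'n set)"
    using finite_same_card_bij[of "{1..l} \<times> {1..3::nat}" "UNIV :: 'n set"] by auto
  have X_inj: "X (i, \<mu>) = X (j, \<nu>) \<longleftrightarrow> i = j \<and> \<mu> = \<nu>"
    if "i \<in> {1..l}" "\<mu> \<in> {1..3}" "j \<in> {1..l}" "\<nu> \<in> {1..3}" for i \<mu> j \<nu>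
    using X that unfolding bij_betw_def inj_on_def by blast
  \<comment> \<open>All-one checks on the groups suffice, because the generators
    \<open>p i \<mu>\<close> are scaled to have sum \<open>0\<close>.\<close>
  define h :: "nat \<Rightarrow> 'a ^ 'n" where "h i = (\<chi> x. if x \<in> (\<lambda>\<mu>. X (i, \<mu>)) ` {1..3} then 1 else 0)" for i
  have supp_h: "supp (h i) = (\<lambda>\<mu>. X (i, \<mu>)) ` {1..3}" for i
    by (auto simp: supp_def h_def)
  have X_inj_on: "inj_on (\<lambda>\<mu>. X (i, \<mu>)) {1..3}" if "i \<in> {1..l}" for i
    using X_inj that by (intro inj_onI) blast
  interpret repair_groups h l
  proof
    show "card (supp (h i)) = 3" if "i \<in> {1..l}" for i
      unfolding supp_h using X_inj_on[OF that] by (simp add: card_image)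
    show "supp (h i) \<inter> supp (h j) = {}" if "i \<in> {1..l}" "j \<in> {1..l}" "i \<noteq> j" for i j
      unfolding supp_h using X_inj that by blast
  qed (rule n)
  have pos: "bij_betw (\<lambda>\<mu>. X (i, \<mu>)) {1..3} (supp (h i))" if "i \<in> {1..l}" for i
    using X_inj_on[OF that] by (simp add: bij_betw_def supp_h)
  have pairing_h: "pairing (h i) c = c $ X (i, 1) + c $ X (i, 2) + c $ X (i, 3)"
    if i: "i \<in> {1..l}" for i c
  proof -
    have "pairing (h i) c = (\<Sum>x\<in>(\<lambda>\<mu>. X (i, \<mu>)) ` {1..3}. c $ x)"
      unfolding pairing_supp supp_h by (rule sum.cong) (auto simp: h_def)
    also have "\<dots> = (\<Sum>\<mu>\<in>{1..3}. c $ X (i, \<mu>))" by (subst sum.reindex[OF X_inj_on[OF i]]) simp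
    also have "{1..3} = {1, 2, 3::nat}" by auto
    finally show ?thesis by (simp add: add.assoc)
  qed

  \<comment> \<open>The unit vectors at the coordinates of group \<open>i\<close> go to \<open>0\<close>, \<open>p i 3\<close>, \<open>- p i 2\<close>, whose pairwise
    differences are the \<open>p i \<mu>\<close> up to sign.\<close>
  define \<phi> :: "'a ^ 'n \<Rightarrow> 'a ^ 4" where
    "\<phi> c = (\<Sum>i\<in>{1..l}. c $ X (i, 2) *s p i 3 - c $ X (i, 3) *s p i 2)" for c
  have lin: "Vector_Spaces.linear (*s) (*s) \<phi>"
  proof
    show "\<phi> (x + y) = \<phi> x + \<phi> y" for x y
      by (simp add: \<phi>_def sum.distrib[symmetric] vec.scale_left_distrib algebra_simps)
    show "\<phi> (k *s x) = k *s \<phi> x" for k x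
      by (simp add: \<phi>_def vec.scale_sum_right vec.scale_right_diff_distrib)
  qed
  interpret f: Vector_Spaces.linear "(*s)" "(*s)" \<phi> by (rule lin)
  have \<phi>_local: "\<phi> c = c $ X (i, 2) *s p i 3 - c $ X (i, 3) *s p i 2"
    and c_local: "c $ X (i, 1) = - c $ X (i, 2) - c $ X (i, 3)"
    if i: "i \<in> {1..l}" and c: "c \<in> local_words i" for i c
  proof -
    have "c $ X (j, \<mu>) = 0" if "j \<in> {1..l}" "j \<noteq> i" "\<mu> \<in> {1..3}" for j \<mu>
    proof -
      have "X (j, \<mu>) \<notin> supp (h i)" unfolding supp_h using X_inj i that by auto
      then show ?thesis using c unfolding local_words_def by (auto simp: supp_def)
    qed
    then have "\<phi> c = (\<Sum>j\<in>{1..l}. if j = i then c $ X (i, 2) *s p i 3 - c $ X (i, 3) *s p i 2 else 0)"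
      unfolding \<phi>_def using m3 by (intro sum.cong) auto
    then show "\<phi> c = c $ X (i, 2) *s p i 3 - c $ X (i, 3) *s p i 2" using i by simp
    have "c $ X (i, 1) + c $ X (i, 2) + c $ X (i, 3) = 0"
      using c pairing_h[OF i] unfolding local_words_def by simp
    then show "c $ X (i, 1) = - c $ X (i, 2) - c $ X (i, 3)"
      by (simp add: eq_diff_eq eq_neg_iff_add_eq_0 ac_simps)
  qed
  \<comment> \<open>A local word in the kernel gives a vector \<open>v\<close> common to the
    distinct points \<open>P i 2\<close> and \<open>P i 3\<close>, so \<open>v = 0\<close> and both
    remaining coordinates vanish.\<close>
  have ker: "c = 0" if i: "i \<in> {1..l}" and c: "c \<in> local_words i" and 0: "\<phi> c = 0" for i c
  proof -
    have neq: "P i 2 \<noteq> P i 3" using inj_on_eq_iff[OF cfg(3)[OF i] m3(2,3)] by simp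
    have eq: "c $ X (i, 2) *s p i 3 = c $ X (i, 3) *s p i 2" using \<phi>_local[OF i c] 0 by simp
    define v where "v = c $ X (i, 2) *s p i 3"
    have "v \<in> P i 3" unfolding v_def
      by (rule vec.subspace_scale[OF P(1)[OF i m3(3)] p_mem(1)[OF i m3(3)]])
    moreover have "v \<in> P i 2" unfolding v_def eq
      by (rule vec.subspace_scale[OF P(1)[OF i m3(2)] p_mem(1)[OF i m3(2)]])
    ultimately have "v = 0"
      using dim_1_span[OF P[OF i m3(2)], of v] dim_1_span[OF P[OF i m3(3)], of v] neq by metis
    then have "c $ X (i, 2) = 0" "c $ X (i, 3) = 0"
      using eq p_mem(2)[OF i m3(2)] p_mem(2)[OF i m3(3)] unfolding v_def by auto
    moreover have "X (i, 2) \<in> supp (h i)" "X (i, 3) \<in> supp (h i)" "X (i, 2) \<noteq> X (i, 3)"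
      using X_inj[OF i _ i] unfolding supp_h by auto
    ultimately show "c = 0" using local_words_eq_0[OF i c] by blast
  qed
  have point: "\<phi> c \<in> P i \<mu>"
    if i: "i \<in> {1..l}" and c: "c \<in> local_words i" and \<mu>: "\<mu> \<in> {1..3}" and 0: "c $ X (i, \<mu>) = 0" for i c \<mu>
  proof -
    note scale = vec.subspace_scale[OF P(1)[OF i \<mu>] p_mem(1)[OF i \<mu>]]
    consider "\<mu> = 1" | "\<mu> = 2" | "\<mu> = 3" using three[OF \<mu>] by blast
    then show ?thesis
    proof cases
      case 1
      then have "c $ X (i, 3) = - c $ X (i, 2)"
        using c_local[OF i c] 0 by (simp add: eq_neg_iff_add_eq_0 add.commute)
      then have "\<phi> c = c $ X (i, 2) *s (p i 2 + p i 3)"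
        using \<phi>_local[OF i c] by (simp add: vec.scale_right_distrib add.commute)
      then have "\<phi> c = (- c $ X (i, 2)) *s p i 1" unfolding p_sum[OF i] by simp
      then show ?thesis using scale 1 by metis
    next
      case 2
      then have "\<phi> c = (- c $ X (i, 3)) *s p i 2" using \<phi>_local[OF i c] 0 by simp
      then show ?thesis using scale 2 by metis
    next
      case 3
      then have "\<phi> c = c $ X (i, 2) *s p i 3" using \<phi>_local[OF i c] 0 by simp
      then show ?thesis using scale 3 by metis
    qed
  qed
  have line: "\<phi> c \<in> U i" if i: "i \<in> {1..l}" and c: "c \<in> local_words i" for i c
    unfolding \<phi>_local[OF that]
    using p_mem(1)[OF i] m3 cfg(5)[OF i]
    by (intro vec.subspace_diff vec.subspace_scale cfg(1)[OF i]) blast+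

  have dim_image: "vec.dim (\<phi> ` S) = vec.dim S"
    if "i \<in> {1..l}" "S \<subseteq> local_words i" "vec.subspace S" for i S
    using vec_dim_image_trivial_kernel[OF lin that(3)] ker[OF that(1)] that(2) by blast
  \<comment> \<open>Here and for the points, injectivity on local words preserves dimensions and
    turns the inclusions into equalities. Vectors of the configuration can thus be lifted to
    words.\<close>
  have image_line: "\<phi> ` local_words i = U i" if i: "i \<in> {1..l}" for i
  proof (rule vec.subspace_dim_equal)
    show "vec.subspace (\<phi> ` local_words i)" by (rule f.subspace_image[OF subspace_local_words])
    show "vec.dim (U i) \<le> vec.dim (\<phi> ` local_words i)"
      using dim_image[OF i order.refl subspace_local_words] dim_local_words[OF i] cfg(2)[OF i] by simp
  qed (use line[OF i] cfg(1)[OF i] in auto)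
  have image_point: "\<phi> ` {c \<in> local_words i. c $ X (i, \<mu>) = 0} = P i \<mu>"
    if i: "i \<in> {1..l}" and \<mu>: "\<mu> \<in> {1..3}" for i \<mu>
  proof -
    have "X (i, \<mu>) \<in> supp (h i)" unfolding supp_h using \<mu> by blast
    note S = dim_local_words_vanishing[OF i this]
    show ?thesis
    proof (rule vec.subspace_dim_equal)
      show "vec.subspace (\<phi> ` {c \<in> local_words i. c $ X (i, \<mu>) = 0})" by (rule f.subspace_image[OF S(1)])
      show "vec.dim (P i \<mu>) \<le> vec.dim (\<phi> ` {c \<in> local_words i. c $ X (i, \<mu>) = 0})"
        using dim_image[OF i _ S(1)] S(2) P(2)[OF i \<mu>] by simp
    qed (use point[OF i _ \<mu>] P(1)[OF i \<mu>] in auto)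
  qed

  define C where "C = {c \<in> words. \<phi> c = 0}"
  have C: "vec.subspace C"
    using subspace_words unfolding C_def vec.subspace_def by (auto simp: f.add f.scale f.zero)
  \<comment> \<open>Two skew lines already span \<open>F\<^sup>4\<close>, so \<open>\<phi>\<close>
    is onto and \<open>C\<close> has codimension exactly \<open>4\<close> in
    \<open>words\<close>.\<close>
  have "\<phi> ` words = UNIV"
  proof -
    have "1 \<in> {1..l}" "2 \<in> {1..l}" using l by auto
    note i = this
    have "x \<in> \<phi> ` words" for x
    proof -
      have "U 1 \<inter> U 2 = {0}" using cfg(6)[OF i] by simp
      then obtain u v where uv: "u \<in> U 1" "v \<in> U 2" "x = u + v"
        by (rule complementary_planes[OF cfg(1,2)[OF i(1)] cfg(1,2)[OF i(2)]])
      then have "u \<in> \<phi> ` words" "v \<in> \<phi> ` words"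
        using image_line[OF i(1)] image_line[OF i(2)] local_words_subset[OF i(1)]
          local_words_subset[OF i(2)] by blast+
      then show ?thesis using uv(3) vec.subspace_add[OF f.subspace_image[OF subspace_words]] by blast
    qed
    then show ?thesis by blast
  qed
  then have "2 * l = vec.dim C + 4"
    using vec_rank_nullity[OF lin subspace_words] dim_words C_def by (simp add: card_cart_basis)
  moreover have "min_dist C = 7"
  proof -
    obtain ca where ca: "ca \<in> local_words s" "ca $ X (s, \<mu>0) = 0" "\<phi> ca = a"
      using DiffD1[OF abr(1)] unfolding image_point[OF stm(1) \<mu>\<nu>(1), symmetric] by auto
    obtain cb where cb: "cb \<in> local_words t" "cb $ X (t, \<nu>0) = 0" "\<phi> cb = b"
      using DiffD1[OF abr(2)] unfolding image_point[OF stm(2) \<mu>\<nu>(2), symmetric] by auto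
    obtain cr where cr: "cr \<in> local_words m" "\<phi> cr = r"
      using abr(3) unfolding image_line[OF stm(3), symmetric] by auto
    \<comment> \<open>The relation \<open>a + b + r = 0\<close> lifts to a codeword: the first two
      summands vanish at a coordinate of their groups and weigh at most \<open>2\<close>, the third
      at most \<open>3\<close>.\<close>
    define c where "c = ca + cb + cr"
    have "ca \<in> words" "cb \<in> words" "cr \<in> words"
      using ca(1) cb(1) cr(1) local_words_subset stm(1-3) by blast+
    then have "c \<in> words"
      unfolding c_def by (intro vec.subspace_add[OF subspace_words])
    moreover have "\<phi> c = 0" unfolding c_def f.add ca(3) cb(3) cr(2) by (rule abr(4))
    ultimately have "c \<in> C" unfolding C_def by blast
    moreover have "c \<noteq> 0"
    proof
      assume "c = 0"
      then have "part s ca + part s cb + part s cr = 0" unfolding c_def by (metis part_add part_0)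
      then have "ca = 0"
        using part_local_words[OF stm(1,1) ca(1)] part_local_words[OF stm(1,2) cb(1)]
          part_local_words[OF stm(1,3) cr(1)] stm(4,5) by simp
      then show False using ca(3) abr(1) f.zero by simp
    qed
    moreover have "card (supp c) \<le> 7"
    proof -
      have "X (s, \<mu>0) \<in> supp (h s)" "X (t, \<nu>0) \<in> supp (h t)" unfolding supp_h using \<mu>\<nu> by blast+
      then have "card (supp ca) \<le> 2" "card (supp cb) \<le> 2"
        using local_words_vanishing stm(1,2) ca(1,2) cb(1,2) by blast+
      moreover have "card (supp cr) \<le> 3"
        using local_words_card_supp(2)[OF stm(3) cr(1)] by (cases "cr = 0") (simp_all add: supp_0)
      ultimately show ?thesis
        using card_supp_add[of "ca + cb" cr] card_supp_add[of ca cb] unfolding c_def by linarith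
    qed
    moreover have "7 \<le> card (supp c)" if "c \<in> C" "c \<noteq> 0" for c
    proof (rule weight_of_line_config[where pos = "\<lambda>i \<mu>. X (i, \<mu>)", OF lin config pos ker line point])
      show "c \<in> words" "\<phi> c = 0" "c \<noteq> 0" using that by (simp_all add: C_def)
    qed
    ultimately show ?thesis by (rule min_dist_eqI[OF C])
  qed
  moreover have dual: "h i \<in> dual_code C" if "i \<in> {1..l}" for i
    using that unfolding mem_dual_code C_def words_def by blast
  have "has_locality C 2"
    unfolding has_locality_def hamming_weight_def
  proof
    fix x
    obtain i where "i \<in> {1..l}" "x \<in> supp (h i)" using covered by blast
    then show "\<exists>h\<in>dual_code C. x \<in> supp h \<and> card (supp h) \<le> 2 + 1"
      using dual card_supp by (intro bexI[of _ "h i"]) auto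
  qed
  \<comment> \<open>The dimension is \<open>2 * l - 4\<close>, which is positive since
    \<open>l\<close> is at least \<open>3\<close>.\<close>
  ultimately have "singleton_optimal_lrc C (vec.dim C) 7 2"
    using C n l unfolding singleton_optimal_lrc_def linear_code_def by simp
  moreover have "disjoint_repair_groups C 2"
    unfolding disjoint_repair_groups_def hamming_weight_def
    using dual card_supp disjoint n by (intro conjI exI[of _ h]) simp_all
  ultimately show ?thesis by blast
qed

theorem theorem8:
  fixes q n l :: nat
  assumes "primepow q" and "CARD('a::{field,finite}) = q"
    and "CARD('n::finite) = n" and "3 dvd n" and "n \<ge> 9" and "l = n div 3"
  shows "(\<exists>(C :: ('a ^ 'n) set) k. singleton_optimal_lrc C k 7 2 \<and> disjoint_repair_groups C 2)
    \<longleftrightarrow> (\<exists>L :: nat \<Rightarrow> ('a ^ 4) set set.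
          (\<forall>i\<in>{1..l}. L i \<in> pg_lines) \<and>
          (\<forall>i\<in>{1..l}. \<forall>j\<in>{1..l}. i \<noteq> j \<longrightarrow> L i \<inter> L j = {}) \<and>
          (\<exists>P :: nat \<Rightarrow> nat \<Rightarrow> ('a ^ 4) set.
             (\<forall>i\<in>{1..l}. inj_on (P i) {1..3} \<and> (\<forall>\<mu>\<in>{1..3}. P i \<mu> \<in> L i)) \<and>
             (\<forall>s t m. 1 \<le> s \<and> s < t \<and> t < m \<and> m \<le> l \<longrightarrow>
                (\<forall>\<mu>\<in>{1..3}. \<forall>\<nu>\<in>{1..3}. \<forall>\<omega>\<in>{1..3}.
                   \<not> pg_collinear (P s \<mu>) (P t \<nu>) (P m \<omega>)))))"
proof -
  \<comment> \<open>The bound \<open>n \<ge> 9\<close> becomes \<open>3 \<le> l\<close>, which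
    supplies the three lines among which a codeword of weight \<open>7\<close> is found.\<close>
  have n: "CARD('n) = 3 * l" and l: "3 \<le> l" using assms by auto
  show ?thesis
    unfolding line_config_iff[symmetric]
    using line_config_of_code[OF n] code_of_line_config[OF n l] by blast
qed

end
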